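(* Consider the iterates of algorithm DP-SCC-PL described in the context, under all the assumptions listed there (network, lower boundedness, smoothness, sampling, bounded variance/heterogeneity, P-Ł condition), with the constants defined there. Suppose that the contraction constant satisfies $0\le\rho<\lambda/(4\sqrt{|\mathcal R|})$ such that $\varphi,\eta,\phi\in(0,1)$, and that the decaying step-size $\alpha_k=\underline\theta/(k+k_0)$ is used. If $\varpi=\rho=0$, then $$\lim_{K\to\infty}\mathbb E f_{K+1}^{\mathrm{best}}=f^* .$$
   Context: **Network.** $\mathcal G=(\mathcal V,\mathcal E)$ is a static undirected network of $m=|\mathcal V|$ agents; $\mathcal V$ is the disjoint union of the set $\mathcal R$ of reliable agents and the set $\mathcal B$ of Byzantine agents. For $i\in\mathcal R$, $\mathcal R_i$ and $\mathcal B_i$ are its sets of reliable and Byzantine neighbors (not including $i$), and $\mathcal N_i=\mathcal R_i\cup\mathcal B_i$. The weight matrix $W=[w_{ij}]\in\mathbb R^{m\times m}$ associated with $\mathcal G$ ($w_{ij}=0$ if $j\ne i$ is not a neighbor of $i$) is nonnegative and doubly stochastic, $W\mathbf 1=\mathbf 1$, $\mathbf 1^\top W=\mathbf 1^\top$, with $w_{ii}>0$ for $i\in\mathcal R$. The reliable agents form a connected undirected network $\mathcal G_{\mathcal R}=(\mathcal R,\mathcal E_{\mathcal R})$. **Problem.** Minimize $f(x)=\frac1{|\mathcal R|}\sum_{i\in\mathcal R}f_i(x)$ over $x\in\mathbb R^n$, where $f_i(x)=\mathbb E_{\xi_i\sim\mathcal D_i}f_i(x,\xi_i)$ and $\mathbb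 E\nabla f_i(x,\xi_i)=\nabla f_i(x)$. **Assumptions on the objectives.** (Feasibility) $f^*:=\inf_{x\in\mathbb R^n}f(x)>-\infty$. (Smoothness) Each $f_i$, $i\in\mathcal R$, has an $L_i$-Lipschitz gradient, $L_i>0$, so that $f_i(y)-f_i(x)-\langle\nabla f_i(x),y-x\rangle\le\frac{L_i}{2}\|y-x\|_2^2$ for all $x,y$; $L:=\max_{i\in\mathcal R}L_i$. (Sampling) The stochastic sampling processes associated with $\{\xi_{i,k}\}_{i\in\mathcal R,k\ge0}$ ($\xi_{i,k}\sim\mathcal D_i$) are independent over iterations $k=0,1,2,\dots$ and over reliable agents; sampling is uniform and without replacement. (Bounded variance and heterogeneity) There are constants $\sigma,\zeta>0$ such that for all $i\in\mathcal R$ and $x\in\mathbb R^n$: $\mathbb E\|\nabla f_i(x,\xi_i)-\nabla f_i(x)\|_2^2\le\sigma^2$ and $\big\|\mathbb E\nabla f_i(x,\xi_i)-\frac1{|\mathcal R|}\sum_{j\in\mathcal R}\mathbb E\nabla f_j(x,\xi_j)\big\|_2^2\le\zeta^2$. (P-Ł condition) For a constant $\nu>0$, $\frac12\|\nabla f(x)\|_2^2\ge\nu(f(x)-f^* )$ for all $x\in\mathbb R^n$. **Self-centered clipping (SCC).** With clipping parameter $\tau_i$, $\mathrm{Clip}\{v,\tau\}=v\cdot\min\{1,\tau/\|v\|_2\}$ and $$SCC_i\{\tilde x_i^i,\{\tilde x_j^i\}_{j\in\mathcal N_i}\}=\sum_{j\in\mathcal N_i\cup\{i\}}w_{ij}\big(\tilde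 x_i^i+\mathrm{Clip}\{\tilde x_j^i-\tilde x_i^i,\tau_i\}\big).$$ **Algorithm DP-SCC-PL.** Given initial $x_{i,0}\in\mathbb R^n$ and step-sizes $\alpha_k>0$, at each $k\ge 0$ each reliable $i$ computes $\tilde g_i(x_{i,k})=\nabla f_i(x_{i,k},\xi_{i,k})+\tilde n_{i,k}$, where $\tilde n_{i,k}\sim N(0,\tilde\varpi_{i,k}^2\mathbf I)$ is Gaussian noise in $\mathbb R^n$ with $0\le\tilde\varpi_{i,k}^2\le\varpi_i^2$ (zero variance meaning no noise); sets $\tilde x_{i,k}^i=x_{i,k}-\alpha_k\tilde g_i(x_{i,k})$; sends $\tilde x_{i,k}^j=\tilde x_{i,k}^i$ to all neighbors $j$; receives $\tilde x_{j,k}^i$ from all $j\in\mathcal N_i$; and sets $x_{i,k+1}=SCC_i\{\tilde x_{i,k}^i,\{\tilde x_{j,k}^i\}_{j\in\mathcal N_i}\}$. Byzantine agents send arbitrary vectors, possibly different to different neighbors. $\varpi^2:=\max_{i\in\mathcal R}\varpi_i^2$. **Virtual weight matrix and contraction constant.** $\tilde W=[\tilde w_{ij}]\in\mathbb R^{|\mathcal R|\times|\mathcal R|}$ has $\tilde w_{ii}=w_{ii}+\sum_{j\in\mathcal B_i}w_{ij}$ and $\tilde w_{ij}=w_{ij}$ for $j\ne i$; $\tilde W$ is doubly stochastic. A constant $\rho\ge0$ is a contraction constant of SCC if for all $i\in\mathcal R$ $$\big\|SCC_i(\tilde x_i^i,\{\tilde x_j^i\}_{j\in\mathcal R_i\cup\mathcal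 B_i})-\hat x_i\big\|_2\le\rho\max_{j\in\mathcal R_i\cup\{i\}}\|\tilde x_j^i-\hat x_i\|_2,\qquad \hat x_i:=\sum_{j\in\mathcal R_i\cup\{i\}}\tilde w_{ij}\tilde x_j^i .$$ It is assumed that $\rho$ is such a constant for the SCC steps of the algorithm. **Constants.** $\lambda:=1-\|\tilde W-\frac1{|\mathcal R|}\mathbf 1\mathbf 1^\top\|_2^2$, $\varphi:=\lambda-4\rho\sqrt{|\mathcal R|}$, $\eta:=\varphi/2$, $\phi:=\varphi/(4-\varphi)$, $\theta:=\phi/(4\sqrt3L)$, $\underline\theta:=\min\{\theta,1/\nu\}$, $k_0>2/\phi$. **Error measure.** $\bar x_k:=\frac1{|\mathcal R|}\sum_{i\in\mathcal R}x_{i,k}$; $\mathbb E f_{K+1}^{\mathrm{best}}:=\min_{k\in\{1,\dots,K+1\}}\mathbb E f(\bar x_k)$. *)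

theory Defs
  imports "HOL-Probability.Probability"
begin

definition grad :: "('a::real_inner \<Rightarrow> real) \<Rightarrow> 'a \<Rightarrow> 'a" where
  "grad g x = (THE d. GDERIV g x :> d)"

lemma GDERIV_imp_grad:
  assumes "GDERIV g x :> d"
  shows "grad g x = d"
  unfolding grad_def
proof (rule the_equality)
  fix d' assume "GDERIV g x :> d'"
  then have "(\<lambda>h. inner h d') = (\<lambda>h. inner h d)"
    using assms has_derivative_unique unfolding gderiv_def by blast
  then have "inner (d' - d) d' = inner (d' - d) d" by (rule fun_cong)
  then have "inner (d' - d) (d' - d) = 0" by (simp add: inner_diff_right)
  then show "d' = d" by simp
qed (rule assms)

lemma differentiable_imp_GDERIV_grad:
  fixes g :: "'a::euclidean_space \<Rightarrow> real"
  assumes "g differentiable (at x)"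
  shows "GDERIV g x :> grad g x"
proof -
  obtain g' where g': "(g has_derivative g') (at x)"
    using assms unfolding differentiable_def by blast
  interpret linear g' using g' by (rule has_derivative_linear)
  have "g' = (\<lambda>h. inner h (\<Sum>b\<in>Basis. g' b *\<^sub>R b))"
  proof
    fix h
    have "g' h = g' (\<Sum>b\<in>Basis. inner h b *\<^sub>R b)" by (simp add: euclidean_representation)
    also have "\<dots> = (\<Sum>b\<in>Basis. inner h b * g' b)" by (simp add: sum scale)
    finally show "g' h = inner h (\<Sum>b\<in>Basis. g' b *\<^sub>R b)"
      by (simp add: inner_sum_right mult.commute)
  qed
  then have "GDERIV g x :> (\<Sum>b\<in>Basis. g' b *\<^sub>R b)"
    using g' unfolding gderiv_def by simp
  then show ?thesis using GDERIV_imp_grad by metis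
qed


text \<open>The vertex set is the whole finite type \<open>'v\<close>; \<open>R\<close> are the reliable and \<open>B\<close> the
  Byzantine agents.\<close>

definition nbrs :: "('v \<times> 'v) set \<Rightarrow> 'v set \<Rightarrow> 'v \<Rightarrow> 'v set" where
  "nbrs E S i = {j \<in> S. (i, j) \<in> E}"

definition agent_network :: "('v::finite \<times> 'v) set \<Rightarrow> 'v set \<Rightarrow> 'v set \<Rightarrow> bool" where
  "agent_network E R B \<longleftrightarrow>
     sym E \<and> irrefl E \<and> R \<union> B = UNIV \<and> R \<inter> B = {} \<and> R \<noteq> {} \<and>
     (\<forall>i\<in>R. \<forall>j\<in>R. (i, j) \<in> (E \<inter> R \<times> R)\<^sup>*)"

definition weight_matrix :: "('v::finite \<times> 'v) set \<Rightarrow> 'v set \<Rightarrow> real^'v^'v \<Rightarrow> bool" where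
  "weight_matrix E R W \<longleftrightarrow>
     (\<forall>i j. 0 \<le> W $ i $ j) \<and>
     (\<forall>i j. j \<noteq> i \<and> (i, j) \<notin> E \<longrightarrow> W $ i $ j = 0) \<and>
     W *v 1 = 1 \<and> 1 v* W = 1 \<and>
     (\<forall>i\<in>R. 0 < W $ i $ i)"

definition virtual_weight ::
  "('v::finite \<times> 'v) set \<Rightarrow> 'v set \<Rightarrow> real^'v^'v \<Rightarrow> 'v \<Rightarrow> 'v \<Rightarrow> real" where
  "virtual_weight E B W i j =
     (if j = i then W $ i $ i + (\<Sum>b\<in>nbrs E B i. W $ i $ b) else W $ i $ j)"

definition doubly_stochastic_on :: "'v set \<Rightarrow> ('v \<Rightarrow> 'v \<Rightarrow> real) \<Rightarrow> bool" where
  "doubly_stochastic_on R A \<longleftrightarrow>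
     (\<forall>i\<in>R. \<forall>j\<in>R. 0 \<le> A i j) \<and>
     (\<forall>i\<in>R. (\<Sum>j\<in>R. A i j) = 1) \<and>
     (\<forall>j\<in>R. (\<Sum>i\<in>R. A i j) = 1)"

text \<open>Spectral norm of the matrix \<open>A\<close> with rows and columns indexed by \<open>R\<close>. Padding with zero
  rows and columns outside of \<open>R\<close> does not change it.\<close>

definition spectral_norm_on :: "'v::finite set \<Rightarrow> ('v \<Rightarrow> 'v \<Rightarrow> real) \<Rightarrow> real" where
  "spectral_norm_on R A =
     onorm ((*v) (\<chi> i j. if i \<in> R \<and> j \<in> R then A i j else 0) :: real^'v \<Rightarrow> real^'v)"


definition clip :: "'a::real_normed_vector \<Rightarrow> real \<Rightarrow> 'a" where
  "clip v t = min 1 (t / norm v) *\<^sub>R v"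

text \<open>\<open>y j\<close> is the vector that agent \<open>i\<close> holds from \<open>j\<close>, with \<open>y i\<close> its own one.\<close>

definition SCC :: "real^'v^'v \<Rightarrow> 'v set \<Rightarrow> real \<Rightarrow> 'v \<Rightarrow> ('v \<Rightarrow> 'a::real_normed_vector) \<Rightarrow> 'a" where
  "SCC W N t i y = (\<Sum>j\<in>N \<union> {i}. W $ i $ j *\<^sub>R (y i + clip (y j - y i) t))"

text \<open>The contraction inequality of one SCC step at agent \<open>i\<close>.\<close>

definition SCC_contraction ::
  "('v::finite \<times> 'v) set \<Rightarrow> 'v set \<Rightarrow> 'v set \<Rightarrow> real^'v^'v \<Rightarrow> real \<Rightarrow> real \<Rightarrow> 'v \<Rightarrow>
     ('v \<Rightarrow> 'a::real_normed_vector) \<Rightarrow> bool" where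
  "SCC_contraction E R B W rho t i y \<longleftrightarrow>
     (let xh = (\<Sum>j\<in>nbrs E R i \<union> {i}. virtual_weight E B W i j *\<^sub>R y j)
      in norm (SCC W (nbrs E R i \<union> nbrs E B i) t i y - xh)
           \<le> rho * Max ((\<lambda>j. norm (y j - xh)) ` (nbrs E R i \<union> {i})))"


text \<open>\<open>F i x s\<close> is the loss of agent \<open>i\<close> at \<open>x\<close> for the sample \<open>s\<close>, and \<open>D i\<close> is the law of
  the samples.\<close>

definition local_obj :: "('v \<Rightarrow> 's measure) \<Rightarrow> ('v \<Rightarrow> 'a \<Rightarrow> 's \<Rightarrow> real) \<Rightarrow> 'v \<Rightarrow> 'a \<Rightarrow> real" where
  "local_obj D F i x = (\<integral>s. F i x s \<partial>D i)"

definition sample_grad :: "('v \<Rightarrow> 'a::real_inner \<Rightarrow> 's \<Rightarrow> real) \<Rightarrow> 'v \<Rightarrow> 'a \<Rightarrow> 's \<Rightarrow> 'a" where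
  "sample_grad F i x s = grad (\<lambda>y. F i y s) x"

definition global_obj ::
  "'v set \<Rightarrow> ('v \<Rightarrow> 's measure) \<Rightarrow> ('v \<Rightarrow> 'a \<Rightarrow> 's \<Rightarrow> real) \<Rightarrow> 'a \<Rightarrow> real" where
  "global_obj R D F x = (\<Sum>i\<in>R. local_obj D F i x) / real (card R)"

definition stochastic_objectives ::
  "'v set \<Rightarrow> ('v \<Rightarrow> 's measure) \<Rightarrow> ('v \<Rightarrow> 'a::euclidean_space \<Rightarrow> 's \<Rightarrow> real) \<Rightarrow> bool" where
  "stochastic_objectives R D F \<longleftrightarrow>
     (\<forall>i\<in>R. prob_space (D i) \<and>
        (\<forall>x. integrable (D i) (F i x)) \<and>
        (\<forall>s\<in>space (D i). \<forall>x. (\<lambda>y. F i y s) differentiable (at x)) \<and>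
        (\<forall>x. local_obj D F i differentiable (at x)) \<and>
        (\<forall>x. integrable (D i) (sample_grad F i x)) \<and>
        (\<forall>x. (\<integral>s. sample_grad F i x s \<partial>D i) = grad (local_obj D F i) x))"

definition smooth_objectives ::
  "'v set \<Rightarrow> ('v \<Rightarrow> 's measure) \<Rightarrow> ('v \<Rightarrow> 'a::euclidean_space \<Rightarrow> 's \<Rightarrow> real) \<Rightarrow>
     ('v \<Rightarrow> real) \<Rightarrow> bool" where
  "smooth_objectives R D F Lc \<longleftrightarrow>
     (\<forall>i\<in>R. 0 < Lc i \<and> (Lc i)-lipschitz_on UNIV (grad (local_obj D F i)))"

definition bounded_variance_heterogeneity ::
  "'v set \<Rightarrow> ('v \<Rightarrow> 's measure) \<Rightarrow> ('v \<Rightarrow> 'a::euclidean_space \<Rightarrow> 's \<Rightarrow> real) \<Rightarrow>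
     real \<Rightarrow> real \<Rightarrow> bool" where
  "bounded_variance_heterogeneity R D F sig zeta \<longleftrightarrow>
     0 < sig \<and> 0 < zeta \<and>
     (\<forall>i\<in>R. \<forall>x.
        integrable (D i) (\<lambda>s. (norm (sample_grad F i x s - grad (local_obj D F i) x))\<^sup>2) \<and>
        (\<integral>s. (norm (sample_grad F i x s - grad (local_obj D F i) x))\<^sup>2 \<partial>D i) \<le> sig\<^sup>2 \<and>
        (norm ((\<integral>s. sample_grad F i x s \<partial>D i)
               - (1 / real (card R)) *\<^sub>R (\<Sum>j\<in>R. \<integral>s. sample_grad F j x s \<partial>D j)))\<^sup>2
          \<le> zeta\<^sup>2)"

definition PL_condition :: "('a::euclidean_space \<Rightarrow> real) \<Rightarrow> real \<Rightarrow> bool" where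
  "PL_condition f nu \<longleftrightarrow> 0 < nu \<and> (\<forall>x. (norm (grad f x))\<^sup>2 / 2 \<ge> nu * (f x - (INF y. f y)))"

definition sampling_process ::
  "'w measure \<Rightarrow> 'v set \<Rightarrow> ('v \<Rightarrow> 's measure) \<Rightarrow> ('v \<Rightarrow> nat \<Rightarrow> 'w \<Rightarrow> 's) \<Rightarrow> bool" where
  "sampling_process M R D xi \<longleftrightarrow>
     (\<forall>i\<in>R. \<forall>k. distr M (D i) (xi i k) = D i) \<and>
     prob_space.indep_vars M (\<lambda>(i, k). D i) (\<lambda>(i, k). xi i k) (R \<times> UNIV)"


text \<open>The law \<open>N(0, s\<^sup>2 I)\<close>; it is the Dirac measure at the origin if \<open>s = 0\<close>.\<close>

definition iso_gaussian :: "real \<Rightarrow> (real^'n) measure" where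
  "iso_gaussian s =
     (if s = 0 then return borel 0
      else density lborel (\<lambda>v. ennreal (\<Prod>j\<in>UNIV. normal_density 0 s (v $ j))))"

text \<open>\<open>sd i k\<close> is the standard deviation at agent \<open>i\<close> and iteration \<open>k\<close>, and \<open>vp i\<close> bounds
  it over the iterations.\<close>

definition gaussian_noise ::
  "'w measure \<Rightarrow> 'v set \<Rightarrow> ('v \<Rightarrow> real) \<Rightarrow> ('v \<Rightarrow> nat \<Rightarrow> real) \<Rightarrow>
     ('v \<Rightarrow> nat \<Rightarrow> 'w \<Rightarrow> real^'n) \<Rightarrow> bool" where
  "gaussian_noise M R vp sd noise \<longleftrightarrow>
     (\<forall>i\<in>R. \<forall>k. (sd i k)\<^sup>2 \<le> (vp i)\<^sup>2 \<and>
        noise i k \<in> borel_measurable M \<and> distr M borel (noise i k) = iso_gaussian (sd i k))"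


text \<open>Vector that agent \<open>i\<close> holds from agent \<open>j\<close> at iteration \<open>k\<close>: a reliable \<open>j\<close> sends its
  local update \<open>xt k j\<close> to everybody (and \<open>i\<close> keeps its own one), whereas a Byzantine \<open>j\<close>
  sends the arbitrary vector \<open>z k j i\<close>.\<close>

definition received ::
  "'v set \<Rightarrow> (nat \<Rightarrow> 'v \<Rightarrow> 'w \<Rightarrow> 'a) \<Rightarrow> (nat \<Rightarrow> 'v \<Rightarrow> 'v \<Rightarrow> 'w \<Rightarrow> 'a) \<Rightarrow>
     nat \<Rightarrow> 'v \<Rightarrow> 'w \<Rightarrow> 'v \<Rightarrow> 'a" where
  "received R xt z k i om j = (if j \<in> R then xt k j om else z k j i om)"

definition DP_SCC_PL ::
  "'w measure \<Rightarrow> ('v::finite \<times> 'v) set \<Rightarrow> 'v set \<Rightarrow> 'v set \<Rightarrow> real^'v^'v \<Rightarrow>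
     (nat \<Rightarrow> 'v \<Rightarrow> 'w \<Rightarrow> real) \<Rightarrow> ('v \<Rightarrow> 'a::real_inner \<Rightarrow> 's \<Rightarrow> real) \<Rightarrow>
     ('v \<Rightarrow> nat \<Rightarrow> 'w \<Rightarrow> 's) \<Rightarrow> ('v \<Rightarrow> nat \<Rightarrow> 'w \<Rightarrow> 'a) \<Rightarrow> (nat \<Rightarrow> real) \<Rightarrow>
     (nat \<Rightarrow> 'v \<Rightarrow> 'v \<Rightarrow> 'w \<Rightarrow> 'a) \<Rightarrow> ('v \<Rightarrow> 'a) \<Rightarrow>
     (nat \<Rightarrow> 'v \<Rightarrow> 'w \<Rightarrow> 'a) \<Rightarrow> (nat \<Rightarrow> 'v \<Rightarrow> 'w \<Rightarrow> 'a) \<Rightarrow> bool" where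
  "DP_SCC_PL M E R B W tau F xi noise alpha z x0 x xt \<longleftrightarrow>
     (\<forall>i\<in>R. \<forall>om\<in>space M.
        x 0 i om = x0 i \<and>
        (\<forall>k. xt k i om =
               x k i om - alpha k *\<^sub>R (sample_grad F i (x k i om) (xi i k om) + noise i k om) \<and>
             x (Suc k) i om =
               SCC W (nbrs E R i \<union> nbrs E B i) (tau k i om) i (received R xt z k i om)))"

definition mean_iterate ::
  "'v set \<Rightarrow> (nat \<Rightarrow> 'v \<Rightarrow> 'w \<Rightarrow> 'a::real_vector) \<Rightarrow> nat \<Rightarrow> 'w \<Rightarrow> 'a" where
  "mean_iterate R x k om = (1 / real (card R)) *\<^sub>R (\<Sum>i\<in>R. x k i om)"

definition expected_best ::
  "'w measure \<Rightarrow> ('a \<Rightarrow> real) \<Rightarrow> (nat \<Rightarrow> 'w \<Rightarrow> 'a) \<Rightarrow> nat \<Rightarrow> real" where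
  "expected_best M f xb N = (MIN k\<in>{1..N}. \<integral>om. f (xb k om) \<partial>M)"

end

theory Submission
  imports Defs
begin

text \<open>
  If the contraction constant is zero, the contraction inequality forces every clipped aggregate to
  equal the weighted mean of the reliable messages with the virtual weights
  (\<open>SCC_eq_weighted_sum\<close>), so the Byzantine agents have no influence. If the privacy noise has
  variance zero, it vanishes almost surely (\<open>gaussian_noise_zero_AE\<close>). Thus the reliable iterates
  agree almost surely with decentralized stochastic gradient descent, in which agents take
  stochastic gradient steps and then mix with a doubly stochastic matrix whose distance from the
  averaging matrix has spectral norm less than one.

  For this process the state at time \<open>k\<close> is a function of the samples drawn before \<open>k\<close>, so by Fubini
  the gradient noise at time \<open>k\<close> has mean zero and bounded variance given the state
  (\<open>independent_centred_noise\<close>). Two recursions for expectations follow. The disagreement of the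
  agents contracts by a fixed factor and is perturbed by \<open>O((alpha k)\<^sup>2)\<close>
  (\<open>disagreement_step\<close>), so it tends to zero. The suboptimality of the averaged iterate contracts by
  \<open>1 - alpha k * nu\<close>, by smoothness and the Polyak-Lojasiewicz inequality, and is perturbed by
  \<open>alpha k\<close> times the disagreement plus \<open>O((alpha k)\<^sup>2)\<close> (\<open>fbar_step\<close>). As the
  step-sizes tend to zero but have a divergent sum, an elementary lemma on perturbed
  contractions (\<open>perturbed_contraction_tendsto_zero\<close>) yields convergence of the expected objective
  to its infimum along the whole sequence, and a fortiori of its running minimum.
\<close>

section \<open>Perturbed contractions\<close>

text \<open>Both limits of the convergence proof, consensus and optimality, come from this recursion.
  Once \<open>e k < \<epsilon> / 2\<close>, the excess \<open>a k - \<epsilon> / 2\<close> is multiplied by at most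
  \<open>1 - b k \<le> exp (- b k)\<close> in every step, and the product of these factors tends to zero because
  the sum of the \<open>b k\<close> diverges.\<close>

lemma perturbed_contraction_tendsto_zero:
  fixes a b e :: "nat \<Rightarrow> real"
  assumes nonneg: "\<And>k. 0 \<le> a k"
    and step: "\<forall>\<^sub>F k in sequentially. a (Suc k) \<le> (1 - b k) * a k + b k * e k"
    and b: "\<forall>\<^sub>F k in sequentially. 0 \<le> b k \<and> b k \<le> 1"
    and diverges: "filterlim (\<lambda>n. \<Sum>k<n. b k) at_top sequentially"
    and e: "e \<longlonglongrightarrow> 0"
  shows "a \<longlonglongrightarrow> 0"
proof (rule LIMSEQ_I)
  fix \<epsilon> :: real assume "\<epsilon> > 0"
  have "\<forall>\<^sub>F k in sequentially. e k < \<epsilon> / 2"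
    using e \<open>\<epsilon> > 0\<close> by (intro order_tendstoD) auto
  with step b have "\<forall>\<^sub>F k in sequentially.
      a (Suc k) \<le> (1 - b k) * a k + b k * e k \<and> 0 \<le> b k \<and> b k \<le> 1 \<and> e k < \<epsilon> / 2"
    by eventually_elim auto
  then obtain N where N: "\<And>k. k \<ge> N \<Longrightarrow>
      a (Suc k) \<le> (1 - b k) * a k + b k * e k \<and> 0 \<le> b k \<and> b k \<le> 1 \<and> e k < \<epsilon> / 2"
    unfolding eventually_sequentially by blast
  define c where "c = \<bar>a N\<bar>"
  have bound: "a n \<le> \<epsilon> / 2 + c * exp (- (\<Sum>k\<in>{N..<n}. b k))" if "n \<ge> N" for n
    using that
  proof (induction n rule: dec_induct)
    case base
    then show ?case using \<open>\<epsilon> > 0\<close> by (simp add: c_def)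
  next
    case (step n)
    have "1 + - b n \<le> exp (- b n)" by (rule exp_ge_add_one_self)
    have "a (Suc n) \<le> (1 - b n) * a n + b n * (\<epsilon> / 2)"
      using N[of n] step(1) mult_left_mono[of "e n" "\<epsilon> / 2" "b n"] by linarith
    also have "\<dots> \<le> (1 - b n) * (\<epsilon> / 2 + c * exp (- (\<Sum>k\<in>{N..<n}. b k))) + b n * (\<epsilon> / 2)"
      using N[of n] step by (intro add_right_mono mult_left_mono) auto
    also have "\<dots> = \<epsilon> / 2 + (1 - b n) * (c * exp (- (\<Sum>k\<in>{N..<n}. b k)))"
      by (simp add: field_simps)
    also have "\<dots> \<le> \<epsilon> / 2 + exp (- b n) * (c * exp (- (\<Sum>k\<in>{N..<n}. b k)))"
      using \<open>1 + - b n \<le> exp (- b n)\<close> by (intro add_left_mono mult_right_mono) (auto simp: c_def)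
    also have "exp (- b n) * (c * exp (- (\<Sum>k\<in>{N..<n}. b k))) = c * exp (- (\<Sum>k\<in>{N..<Suc n}. b k))"
      using step(1) by (simp add: exp_add[symmetric] algebra_simps)
    finally show ?case .
  qed
  have "filterlim (\<lambda>n. - (\<Sum>k<N. b k) + (\<Sum>k<n. b k)) at_top sequentially"
    using diverges by (intro filterlim_tendsto_add_at_top[OF tendsto_const])
  moreover have "\<forall>\<^sub>F n in sequentially. - (\<Sum>k<N. b k) + (\<Sum>k<n. b k) = (\<Sum>k\<in>{N..<n}. b k)"
    unfolding eventually_sequentially
  proof (intro exI[of _ N] allI impI)
    fix n assume "N \<le> n"
    then show "- (\<Sum>k<N. b k) + (\<Sum>k<n. b k) = (\<Sum>k\<in>{N..<n}. b k)"
      using sum.atLeastLessThan_concat[of 0 N n b] by (simp add: lessThan_atLeast0)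
  qed
  ultimately have "filterlim (\<lambda>n. (\<Sum>k\<in>{N..<n}. b k)) at_top sequentially"
    by (rule filterlim_cong[OF refl refl, THEN iffD1, rotated])
  then have "((\<lambda>n. exp (- (\<Sum>k\<in>{N..<n}. b k))) \<longlongrightarrow> 0) sequentially"
    by (intro filterlim_compose[OF exp_at_bot]) (simp add: filterlim_uminus_at_top)
  then have "((\<lambda>n. c * exp (- (\<Sum>k\<in>{N..<n}. b k))) \<longlongrightarrow> 0) sequentially"
    by (rule tendsto_mult_right_zero)
  then have "\<forall>\<^sub>F n in sequentially. c * exp (- (\<Sum>k\<in>{N..<n}. b k)) < \<epsilon> / 2"
    using \<open>\<epsilon> > 0\<close> by (intro order_tendstoD) auto
  then obtain N' where N': "\<And>n. n \<ge> N' \<Longrightarrow> c * exp (- (\<Sum>k\<in>{N..<n}. b k)) < \<epsilon> / 2"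
    unfolding eventually_sequentially by blast
  show "\<exists>no. \<forall>n\<ge>no. norm (a n - 0) < \<epsilon>"
  proof (intro exI[of _ "max N N'"] allI impI)
    fix n assume "n \<ge> max N N'"
    then show "norm (a n - 0) < \<epsilon>"
      using bound[of n] N'[of n] nonneg[of n] by auto
  qed
qed

text \<open>Up to an index shift the sum dominates a multiple of the harmonic series.\<close>

lemma harmonic_steps_diverge:
  fixes c d :: real
  assumes "c > 0" "d > 0"
  shows "filterlim (\<lambda>n. \<Sum>k<n. c / (real k + d)) at_top sequentially"
proof -
  \<comment> \<open>an integer shift \<open>m \<ge> d\<close> allows the comparison with the harmonic series\<close>
  define m where "m = nat \<lceil>d\<rceil>"
  have "d \<le> real m" by (simp add: m_def real_nat_ceiling_ge)
  have "\<not> summable (\<lambda>k. c / (real k + d))"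
  proof
    assume "summable (\<lambda>k. c / (real k + d))"
    then have "summable (\<lambda>k. inverse c * (c / (real k + d)))" by (rule summable_mult)
    then have "summable (\<lambda>k. 1 / (real k + d))" using assms by (simp add: field_simps)
    then have "summable (\<lambda>k. inverse (of_nat (k + m)) :: real)"
      by (rule summable_comparison_test'[where N=0])
         (use \<open>d \<le> real m\<close> assms in \<open>auto simp: field_simps\<close>)
    then have "summable (\<lambda>k. inverse (of_nat k) :: real)"
      using summable_iff_shift[of "\<lambda>k. inverse (of_nat k) :: real" m] by simp
    then show False using not_summable_harmonic[where 'a=real] by simp
  qed
  then have unbounded: "\<exists>n. Z < (\<Sum>k<n. c / (real k + d))" for Z
    using assms summableI_nonneg_bounded[of "\<lambda>k. c / (real k + d)" Z] by (force simp: not_le)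
  show ?thesis
    unfolding filterlim_at_top_gt[where c=0] eventually_sequentially
  proof (intro allI impI)
    fix Z :: real
    obtain n where n: "Z < (\<Sum>k<n. c / (real k + d))" using unbounded by blast
    have "Z \<le> (\<Sum>k<m. c / (real k + d))" if "n \<le> m" for m
      using n sum_mono2[of "{..<m}" "{..<n}" "\<lambda>k. c / (real k + d)"] that assms by auto
    then show "\<exists>N. \<forall>n\<ge>N. Z \<le> (\<Sum>k<n. c / (real k + d))" by blast
  qed
qed

section \<open>Smooth functions and averages\<close>

text \<open>Along the segment from \<open>x\<close> to \<open>y\<close> the difference of the two sides has derivative of the right
  sign: by Cauchy-Schwarz and the Lipschitz bound, the directional derivative changes by at most
  \<open>L * t * (norm (y - x))\<^sup>2\<close> up to time \<open>t\<close>.\<close>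

lemma descent_lemma:
  fixes f :: "'a::euclidean_space \<Rightarrow> real"
  assumes grad: "\<And>x. GDERIV f x :> G x" and lip: "L-lipschitz_on UNIV G"
  shows "f y \<le> f x + G x \<bullet> (y - x) + L / 2 * (norm (y - x))\<^sup>2"
proof -
  define d where "d = y - x"
  define h where "h t = f (x + t *\<^sub>R d) - t * (G x \<bullet> d) - L / 2 * t\<^sup>2 * (norm d)\<^sup>2" for t :: real
  have der: "DERIV h t :> (G (x + t *\<^sub>R d) - G x) \<bullet> d - L * t * (norm d)\<^sup>2" for t
  proof -
    have "((\<lambda>t. x + t *\<^sub>R d) has_derivative (\<lambda>t. t *\<^sub>R d)) (at t)"
      by (auto intro!: derivative_eq_intros)
    moreover have "(f has_derivative (\<lambda>h. h \<bullet> G (x + t *\<^sub>R d))) (at (x + t *\<^sub>R d))"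
      using grad[of "x + t *\<^sub>R d"] by (simp add: gderiv_def)
    ultimately have "((\<lambda>t. f (x + t *\<^sub>R d)) has_derivative (\<lambda>s. (s *\<^sub>R d) \<bullet> G (x + t *\<^sub>R d))) (at t)"
      by (rule has_derivative_compose)
    then have "DERIV (\<lambda>t. f (x + t *\<^sub>R d)) t :> d \<bullet> G (x + t *\<^sub>R d)"
      by (rule has_derivative_imp_has_field_derivative) simp
    then show ?thesis
      unfolding h_def
      by (auto intro!: derivative_eq_intros simp: inner_diff_left inner_commute algebra_simps)
  qed
  have "h 1 \<le> h 0"
  proof (rule DERIV_nonpos_imp_nonincreasing[where f=h and a=0 and b=1])
    fix t :: real assume t: "0 \<le> t" "t \<le> 1"
    have "(G (x + t *\<^sub>R d) - G x) \<bullet> d \<le> norm (G (x + t *\<^sub>R d) - G x) * norm d"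
      by (rule norm_cauchy_schwarz)
    also have "norm (G (x + t *\<^sub>R d) - G x) \<le> L * norm (t *\<^sub>R d)"
      using lipschitz_onD[OF lip, of "x + t *\<^sub>R d" x] by (simp add: dist_norm)
    finally have "(G (x + t *\<^sub>R d) - G x) \<bullet> d \<le> L * t * (norm d)\<^sup>2"
      using t by (simp add: mult_right_mono power2_eq_square mult.assoc)
    with der[of t] show "\<exists>u. DERIV h t :> u \<and> u \<le> 0" by fastforce
  qed simp
  then show ?thesis by (simp add: h_def d_def)
qed

text \<open>Young's inequality; taking \<open>c\<close> small keeps the factor of the first term close to one, so that a
  contraction of that term survives.\<close>

lemma norm_diff_sq_weighted:
  fixes a b :: "'a::real_inner"
  assumes "c > 0"
  shows "(norm (a - b))\<^sup>2 \<le> (1 + c) * (norm a)\<^sup>2 + (1 + 1 / c) * (norm b)\<^sup>2"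
proof -
  have "0 \<le> (norm (sqrt c *\<^sub>R a + (1 / sqrt c) *\<^sub>R b))\<^sup>2" by simp
  also have "\<dots> = c * (norm a)\<^sup>2 + (1 / c) * (norm b)\<^sup>2 + 2 * (a \<bullet> b)"
    using assms by (simp add: power2_norm_eq_inner inner_add_left inner_add_right inner_commute algebra_simps power2_eq_square[symmetric])
  finally show ?thesis
    by (simp add: power2_norm_eq_inner inner_diff_left inner_diff_right inner_commute algebra_simps)
qed

lemma norm_add3_sq:
  fixes a b c :: "'a::real_inner"
  shows "(norm (a + b + c))\<^sup>2 \<le> 3 * ((norm a)\<^sup>2 + (norm b)\<^sup>2 + (norm c)\<^sup>2)"
proof -
  have "0 \<le> (norm (a - b))\<^sup>2 + (norm (b - c))\<^sup>2 + (norm (a - c))\<^sup>2" by simp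
  then show ?thesis
    by (simp add: power2_norm_eq_inner inner_diff_left inner_diff_right inner_add_left inner_add_right inner_commute algebra_simps)
qed

lemma norm_add_sq:
  fixes a b :: "'a::real_inner"
  shows "(norm (a + b))\<^sup>2 \<le> 2 * (norm a)\<^sup>2 + 2 * (norm b)\<^sup>2"
  using norm_diff_sq_weighted[of 1 a "- b"] by simp

definition avg_on :: "'v set \<Rightarrow> ('v \<Rightarrow> 'a::real_vector) \<Rightarrow> 'a" where
  "avg_on R v = (1 / real (card R)) *\<^sub>R (\<Sum>i\<in>R. v i)"

text \<open>The average minimizes the sum of squared distances, so \<open>c\<close> may be chosen to suit the estimate.\<close>

lemma sum_sq_dev_avg_le:
  fixes v :: "'v \<Rightarrow> 'a::real_inner"
  assumes "finite R" "R \<noteq> {}"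
  shows "(\<Sum>i\<in>R. (norm (v i - avg_on R v))\<^sup>2) \<le> (\<Sum>i\<in>R. (norm (v i - c))\<^sup>2)"
proof -
  let ?m = "avg_on R v"
  have "card R > 0" using assms by (simp add: card_gt_0_iff)
  then have z: "(\<Sum>i\<in>R. v i - ?m) = 0"
    by (simp add: sum_subtractf avg_on_def sum_constant_scaleR)
  have "(\<Sum>i\<in>R. (norm (v i - c))\<^sup>2)
      = (\<Sum>i\<in>R. (norm (v i - ?m))\<^sup>2 + 2 * ((v i - ?m) \<bullet> (?m - c)) + (norm (?m - c))\<^sup>2)"
    by (intro sum.cong refl)
       (simp add: power2_norm_eq_inner inner_diff_left inner_diff_right inner_commute algebra_simps)
  also have "\<dots> = (\<Sum>i\<in>R. (norm (v i - ?m))\<^sup>2) + 2 * ((\<Sum>i\<in>R. v i - ?m) \<bullet> (?m - c))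
      + real (card R) * (norm (?m - c))\<^sup>2"
    by (simp add: sum.distrib inner_sum_left sum_distrib_left)
  finally show ?thesis using z by simp
qed

lemma norm_avg_sq_le:
  fixes v :: "'v \<Rightarrow> 'a::real_inner"
  assumes "finite R" "R \<noteq> {}"
  shows "(norm (avg_on R v))\<^sup>2 \<le> (\<Sum>i\<in>R. (norm (v i))\<^sup>2) / real (card R)"
proof -
  have c: "real (card R) > 0" using assms by (simp add: card_gt_0_iff)
  have "(norm (\<Sum>i\<in>R. v i))\<^sup>2 \<le> (\<Sum>i\<in>R. norm (v i))\<^sup>2"
    by (intro power_mono norm_sum) auto
  also have "\<dots> \<le> (\<Sum>i\<in>R. (norm (v i))\<^sup>2) * real (card R)"
    by (rule order_trans[OF sum_squared_le_sum_of_squares]) auto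
  finally show ?thesis
    using c by (simp add: avg_on_def power_divide divide_simps power2_eq_square)
qed

section \<open>Measurability of stochastic gradients\<close>

text \<open>Caratheodory functions are jointly measurable: replace the first argument by simple functions
  converging to the identity; each approximation is measurable because only finitely many values
  of the first argument occur, and continuity gives the pointwise limit.\<close>

lemma borel_measurable_Caratheodory:
  fixes F :: "'a::{metric_space, second_countable_topology} \<Rightarrow> 's \<Rightarrow> 'b::metric_space"
  assumes meas: "\<And>x. F x \<in> borel_measurable N"
    and cont: "\<And>s. s \<in> space N \<Longrightarrow> continuous_on UNIV (\<lambda>x. F x s)"
  shows "(\<lambda>p. F (fst p) (snd p)) \<in> borel_measurable (borel \<Otimes>\<^sub>M N)"
proof -
  obtain S :: "nat \<Rightarrow> 'a \<Rightarrow> 'a" where S: "\<And>i. simple_function borel (S i)"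
    and lim: "\<And>x. (\<lambda>i. S i x) \<longlonglongrightarrow> x"
    using borel_measurable_implies_sequence_metric[of "\<lambda>x::'a. x" borel undefined] by auto
  show ?thesis
  proof (rule borel_measurable_LIMSEQ_metric)
    fix i
    have fin: "finite (range (S i))" using S[of i] by (simp add: simple_function_def)
    have "(\<lambda>p. S i (fst p)) \<in> measurable (borel \<Otimes>\<^sub>M N) (count_space (range (S i)))"
    proof (rule measurable_compose[OF measurable_fst])
      show "S i \<in> borel \<rightarrow>\<^sub>M count_space (range (S i))"
        unfolding measurable_count_space_eq2[OF fin]
        using simple_functionD(2)[OF S[of i]] by (auto simp del: space_borel)
    qed
    then show "(\<lambda>p. F (S i (fst p)) (snd p)) \<in> borel_measurable (borel \<Otimes>\<^sub>M N)"
      by (rule measurable_compose_countable'[where f="\<lambda>y p. F y (snd p)", rotated])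
         (use fin in \<open>auto intro: countable_finite measurable_compose[OF measurable_snd meas]\<close>)
  next
    fix p :: "'a \<times> 's" assume "p \<in> space (borel \<Otimes>\<^sub>M N)"
    then have "isCont (\<lambda>x. F x (snd p)) (fst p)"
      using cont[of "snd p"] by (auto simp: space_pair_measure continuous_on_eq_continuous_at)
    then show "(\<lambda>i. F (S i (fst p)) (snd p)) \<longlonglongrightarrow> F (fst p) (snd p)"
      using lim by (rule isCont_tendsto_compose)
  qed
qed

text \<open>Exhibits the components of a gradient as limits of a sequence of difference quotients, which is
  what makes gradients measurable in parameters.\<close>

lemma GDERIV_inner_limit:
  fixes g :: "'a::real_inner \<Rightarrow> real"
  assumes "GDERIV g x :> d"
  shows "(\<lambda>n. real (Suc n) * (g (x + (1 / real (Suc n)) *\<^sub>R b) - g x)) \<longlonglongrightarrow> d \<bullet> b"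
proof -
  have "((\<lambda>t::real. x + t *\<^sub>R b) has_derivative (\<lambda>t. t *\<^sub>R b)) (at 0)"
    by (auto intro!: derivative_eq_intros)
  moreover have "(g has_derivative (\<lambda>h. h \<bullet> d)) (at (x + 0 *\<^sub>R b))"
    using assms by (simp add: gderiv_def)
  ultimately have "((\<lambda>t. g (x + t *\<^sub>R b)) has_derivative (\<lambda>s. (s *\<^sub>R b) \<bullet> d)) (at 0)"
    by (rule has_derivative_compose)
  then have "DERIV (\<lambda>t. g (x + t *\<^sub>R b)) 0 :> d \<bullet> b"
    by (rule has_derivative_imp_has_field_derivative) (simp add: inner_commute)
  then have lim: "(\<lambda>t. (g (x + t *\<^sub>R b) - g x) / t) \<midarrow>0\<rightarrow> d \<bullet> b"
    by (simp add: DERIV_def)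
  have "(\<lambda>n. 1 / real (Suc n)) \<longlonglongrightarrow> 0" by (rule LIMSEQ_Suc[OF lim_1_over_n])
  then have "filterlim (\<lambda>n. 1 / real (Suc n)) (at 0) sequentially"
    by (simp add: filterlim_at)
  from filterlim_compose[OF lim this] show ?thesis by (simp add: mult.commute)
qed

text \<open>The iterates and the samples are both random, so the stochastic gradient has to be measurable in
  the pair of them, although the loss is only known to be measurable in the sample for each fixed
  point. Differentiability makes the loss a Caratheodory function, and its difference quotients
  converge to the gradient.\<close>

lemma borel_measurable_sample_grad:
  fixes F :: "'v \<Rightarrow> 'a::euclidean_space \<Rightarrow> 's \<Rightarrow> real"
  assumes meas: "\<And>x. F i x \<in> borel_measurable N"
    and diff: "\<And>s x. s \<in> space N \<Longrightarrow> (\<lambda>y. F i y s) differentiable (at x)"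
  shows "(\<lambda>p. sample_grad F i (fst p) (snd p)) \<in> borel_measurable (borel \<Otimes>\<^sub>M N)"
proof -
  have F: "(\<lambda>p. F i (fst p) (snd p)) \<in> borel_measurable (borel \<Otimes>\<^sub>M N)"
    using meas diff
    by (intro borel_measurable_Caratheodory)
       (auto intro!: differentiable_imp_continuous_on differentiable_at_imp_differentiable_on)
  have shifted: "(\<lambda>p. F i (fst p + v) (snd p)) \<in> borel_measurable (borel \<Otimes>\<^sub>M N)" for v
    using measurable_compose[OF _ F, of "\<lambda>p. (fst p + v, snd p)"] by simp
  have "(\<lambda>p. sample_grad F i (fst p) (snd p) \<bullet> b) \<in> borel_measurable (borel \<Otimes>\<^sub>M N)" for b
  proof (rule borel_measurable_LIMSEQ_metric)
    show "(\<lambda>p. real (Suc n) * (F i (fst p + (1 / real (Suc n)) *\<^sub>R b) (snd p) - F i (fst p) (snd p)))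
        \<in> borel_measurable (borel \<Otimes>\<^sub>M N)" for n
      using F shifted[of "(1 / real (Suc n)) *\<^sub>R b"] by (intro borel_measurable_times borel_measurable_diff) auto
  next
    fix p :: "'a \<times> 's" assume "p \<in> space (borel \<Otimes>\<^sub>M N)"
    then have "GDERIV (\<lambda>y. F i y (snd p)) (fst p) :> sample_grad F i (fst p) (snd p)"
      unfolding sample_grad_def
      by (intro differentiable_imp_GDERIV_grad diff) (auto simp: space_pair_measure)
    from GDERIV_inner_limit[OF this]
    show "(\<lambda>n. real (Suc n) * (F i (fst p + (1 / real (Suc n)) *\<^sub>R b) (snd p) - F i (fst p) (snd p)))
        \<longlonglongrightarrow> sample_grad F i (fst p) (snd p) \<bullet> b" .
  qed
  then show ?thesis
    using borel_measurable_euclidean_space[where f="\<lambda>p. sample_grad F i (fst p) (snd p)"] by blast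
qed

lemma borel_measurable_vec_lambda:
  fixes f :: "'v::finite \<Rightarrow> 'w \<Rightarrow> 'a::euclidean_space"
  assumes "\<And>i. f i \<in> borel_measurable N"
  shows "(\<lambda>w. \<chi> i. f i w) \<in> borel_measurable N"
  unfolding borel_measurable_euclidean_space[where f="\<lambda>w. \<chi> i. f i w"]
  using assms by (auto simp: Basis_vec_def inner_axis)

lemma borel_measurable_vec_nth [measurable]:
  "(\<lambda>x :: 'a::euclidean_space^'v::finite. x $ i) \<in> borel_measurable borel"
  by (intro borel_measurable_continuous_onI continuous_intros)

section \<open>Noise independent of the past\<close>

lemma integrable_inner_of_square_integrable:
  fixes u v :: "'w \<Rightarrow> 'a::euclidean_space"
  assumes [measurable]: "u \<in> borel_measurable M" "v \<in> borel_measurable M"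
    and int: "integrable M (\<lambda>w. (norm (u w))\<^sup>2)" "integrable M (\<lambda>w. (norm (v w))\<^sup>2)"
  shows "integrable M (\<lambda>w. u w \<bullet> v w)"
proof (rule Bochner_Integration.integrable_bound)
  show "integrable M (\<lambda>w. (norm (u w))\<^sup>2 + (norm (v w))\<^sup>2)" using int by simp
  show "AE w in M. norm (u w \<bullet> v w) \<le> norm ((norm (u w))\<^sup>2 + (norm (v w))\<^sup>2)"
  proof (intro always_eventually allI)
    fix w
    have "\<bar>u w \<bullet> v w\<bar> \<le> norm (u w) * norm (v w)" by (rule Cauchy_Schwarz_ineq2)
    also have "\<dots> \<le> (norm (u w))\<^sup>2 + (norm (v w))\<^sup>2"
      using sum_squares_bound[of "norm (u w)" "norm (v w)"]
        mult_nonneg_nonneg[OF norm_ge_zero[of "u w"] norm_ge_zero[of "v w"]] by linarith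
    finally show "norm (u w \<bullet> v w) \<le> norm ((norm (u w))\<^sup>2 + (norm (v w))\<^sup>2)" by simp
  qed
qed simp

text \<open>The substitute for conditional expectations given the past. \<open>Y\<close> is the past, \<open>X\<close> a fresh
  sample and \<open>K (y, _)\<close> the gradient noise at the state \<open>y\<close>. As the joint law of past and sample
  is a product, Fubini allows integrating over the sample first, with the state held fixed; the
  variance bound and the orthogonality of the noise to every function \<open>u\<close> of the past follow from
  the corresponding statements at fixed \<open>y\<close>.\<close>

lemma (in prob_space) independent_centred_noise:
  fixes K :: "'b \<times> 's \<Rightarrow> 'c::euclidean_space" and u :: "'b \<Rightarrow> 'c"
  assumes Y[measurable]: "random_variable N Y" and X[measurable]: "random_variable D X"
    and law: "distr M D X = D"
    and joint: "distr M (N \<Otimes>\<^sub>M D) (\<lambda>w. (Y w, X w)) = distr M N Y \<Otimes>\<^sub>M D"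
    and K[measurable]: "K \<in> borel_measurable (N \<Otimes>\<^sub>M D)"
    and centred: "\<And>y. y \<in> space N \<Longrightarrow> integrable D (\<lambda>s. K (y, s))"
      "\<And>y. y \<in> space N \<Longrightarrow> (\<integral>s. K (y, s) \<partial>D) = 0"
    and var: "\<And>y. y \<in> space N \<Longrightarrow> integrable D (\<lambda>s. (norm (K (y, s)))\<^sup>2)"
      "\<And>y. y \<in> space N \<Longrightarrow> (\<integral>s. (norm (K (y, s)))\<^sup>2 \<partial>D) \<le> \<sigma>\<^sup>2"
    and u[measurable]: "u \<in> borel_measurable N"
    and int_u: "integrable M (\<lambda>w. (norm (u (Y w)))\<^sup>2)"
  shows "integrable M (\<lambda>w. (norm (K (Y w, X w)))\<^sup>2)"
    and "(\<integral>w. (norm (K (Y w, X w)))\<^sup>2 \<partial>M) \<le> \<sigma>\<^sup>2"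
    and "integrable M (\<lambda>w. u (Y w) \<bullet> K (Y w, X w))"
    and "(\<integral>w. u (Y w) \<bullet> K (Y w, X w) \<partial>M) = 0"
proof -
  interpret PY: prob_space "distr M N Y" by (rule prob_space_distr) fact
  interpret PX: prob_space D using prob_space_distr[OF X] law by simp
  interpret P: pair_sigma_finite "distr M N Y" D ..
  have "(\<integral>\<^sup>+w. ennreal ((norm (K (Y w, X w)))\<^sup>2) \<partial>M)
      = (\<integral>\<^sup>+p. ennreal ((norm (K p))\<^sup>2) \<partial>(distr M N Y \<Otimes>\<^sub>M D))"
    unfolding joint[symmetric] by (subst nn_integral_distr) auto
  also have "\<dots> = (\<integral>\<^sup>+y. \<integral>\<^sup>+s. ennreal ((norm (K (y, s)))\<^sup>2) \<partial>D \<partial>distr M N Y)"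
    by (rule PX.nn_integral_fst[symmetric]) (simp add: joint[symmetric])
  also have "\<dots> \<le> (\<integral>\<^sup>+y. ennreal (\<sigma>\<^sup>2) \<partial>distr M N Y)"
    by (rule nn_integral_mono) (use var in \<open>simp add: nn_integral_eq_integral ennreal_leI\<close>)
  also have "\<dots> = ennreal (\<sigma>\<^sup>2)" by (simp add: PY.emeasure_space_1[simplified])
  finally have bound: "(\<integral>\<^sup>+w. ennreal ((norm (K (Y w, X w)))\<^sup>2) \<partial>M) \<le> ennreal (\<sigma>\<^sup>2)" .
  have meas_KYX[measurable]: "(\<lambda>w. K (Y w, X w)) \<in> borel_measurable M"
    by (rule measurable_compose[OF _ K]) measurable
  show int: "integrable M (\<lambda>w. (norm (K (Y w, X w)))\<^sup>2)"
    by (rule integrableI_bounded) (use bound in \<open>auto intro: le_less_trans\<close>)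
  show "(\<integral>w. (norm (K (Y w, X w)))\<^sup>2 \<partial>M) \<le> \<sigma>\<^sup>2"
    using bound nn_integral_eq_integral[OF int] by simp
  show int_inner: "integrable M (\<lambda>w. u (Y w) \<bullet> K (Y w, X w))"
    by (rule integrable_inner_of_square_integrable) (use int int_u in auto)
  have meas_inner: "(\<lambda>p. u (fst p) \<bullet> K p) \<in> borel_measurable (N \<Otimes>\<^sub>M D)" by measurable
  have "(\<integral>w. u (Y w) \<bullet> K (Y w, X w) \<partial>M)
      = (\<integral>p. u (fst p) \<bullet> K p \<partial>(distr M N Y \<Otimes>\<^sub>M D))"
    unfolding joint[symmetric] by (subst integral_distr) (use meas_inner in auto)
  also have "\<dots> = (\<integral>y. \<integral>s. u y \<bullet> K (y, s) \<partial>D \<partial>distr M N Y)"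
  proof -
    have "integrable (distr M N Y \<Otimes>\<^sub>M D) (\<lambda>p. u (fst p) \<bullet> K p)"
      unfolding joint[symmetric] by (subst integrable_distr_eq) (use meas_inner int_inner in auto)
    then show ?thesis by (simp add: P.integral_fst'[symmetric])
  qed
  also have "\<dots> = (\<integral>y. 0 \<partial>distr M N Y)"
    by (rule Bochner_Integration.integral_cong) (use centred in auto)
  finally show "(\<integral>w. u (Y w) \<bullet> K (Y w, X w) \<partial>M) = 0" by simp
qed

text \<open>Here \<open>Z1\<close> and \<open>Z2\<close> stand for two disjoint blocks of samples; the product form passes from
  them to the state computed from the one and the fresh sample read off the other.\<close>

lemma (in prob_space) joint_law_of_independent_functions:
  assumes indep: "indep_var N1 Z1 N2 Z2"
    and f[measurable]: "f \<in> measurable N1 S" and g[measurable]: "g \<in> measurable N2 T"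
  shows "distr M (S \<Otimes>\<^sub>M T) (\<lambda>w. (f (Z1 w), g (Z2 w)))
      = distr M S (\<lambda>w. f (Z1 w)) \<Otimes>\<^sub>M distr M T (\<lambda>w. g (Z2 w))"
proof -
  have [measurable]: "random_variable N1 Z1" "random_variable N2 Z2"
    and joint: "distr M N1 Z1 \<Otimes>\<^sub>M distr M N2 Z2 = distr M (N1 \<Otimes>\<^sub>M N2) (\<lambda>w. (Z1 w, Z2 w))"
    using indep by (auto simp: indep_var_distribution_eq)
  have "prob_space (distr (distr M N2 Z2) T g)"
    by (intro prob_space.prob_space_distr prob_space_distr) auto
  then have sf: "sigma_finite_measure (distr (distr M N2 Z2) T g)"
    by (simp add: prob_space_imp_sigma_finite)
  have "distr M S (\<lambda>w. f (Z1 w)) \<Otimes>\<^sub>M distr M T (\<lambda>w. g (Z2 w))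
      = distr (distr M N1 Z1) S f \<Otimes>\<^sub>M distr (distr M N2 Z2) T g"
    by (simp add: distr_distr comp_def)
  also have "\<dots> = distr (distr M (N1 \<Otimes>\<^sub>M N2) (\<lambda>w. (Z1 w, Z2 w))) (S \<Otimes>\<^sub>M T) (\<lambda>(a, b). (f a, g b))"
    using sf by (subst pair_measure_distr) (auto simp: joint)
  also have "\<dots> = distr M (S \<Otimes>\<^sub>M T) (\<lambda>w. (f (Z1 w), g (Z2 w)))"
    by (subst distr_distr) (auto simp: comp_def)
  finally show ?thesis by simp
qed

section \<open>Square integrable random vectors\<close>

definition square_integrable :: "'w measure \<Rightarrow> ('w \<Rightarrow> 'a::euclidean_space) \<Rightarrow> bool" where
  "square_integrable M g \<longleftrightarrow> g \<in> borel_measurable M \<and> integrable M (\<lambda>w. (norm (g w))\<^sup>2)"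

lemma square_integrable_bound:
  assumes "integrable M h" "g \<in> borel_measurable M" "\<And>w. (norm (g w))\<^sup>2 \<le> h w"
  shows "square_integrable M g"
  unfolding square_integrable_def
proof (intro conjI Bochner_Integration.integrable_bound[OF assms(1)])
  show "AE w in M. norm ((norm (g w))\<^sup>2) \<le> norm (h w)"
    using assms(3) by (auto intro: order_trans[OF _ abs_ge_self])
qed (use assms(2) in auto)

lemma square_integrable_add:
  assumes "square_integrable M g" "square_integrable M h"
  shows "square_integrable M (\<lambda>w. g w + h w)"
  by (rule square_integrable_bound[where h="\<lambda>w. 2 * (norm (g w))\<^sup>2 + 2 * (norm (h w))\<^sup>2"])
     (use assms in \<open>auto simp: square_integrable_def norm_add_sq\<close>)

lemma square_integrable_scaleR:
  assumes "square_integrable M g"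
  shows "square_integrable M (\<lambda>w. c *\<^sub>R g w)"
  using assms by (auto simp: square_integrable_def power_mult_distrib)

lemma square_integrable_diff:
  assumes "square_integrable M g" "square_integrable M h"
  shows "square_integrable M (\<lambda>w. g w - h w)"
  using square_integrable_add[OF assms(1) square_integrable_scaleR[OF assms(2), of "-1"]] by simp

lemma (in prob_space) square_integrable_const: "square_integrable M (\<lambda>w. c)"
  by (simp add: square_integrable_def)

lemma (in prob_space) square_integrable_sum:
  assumes "\<And>i. i \<in> S \<Longrightarrow> square_integrable M (g i)"
  shows "square_integrable M (\<lambda>w. \<Sum>i\<in>S. g i w)"
  using assms
  by (induction S rule: infinite_finite_induct) (auto intro: square_integrable_const square_integrable_add)

lemma (in prob_space) square_integrable_lipschitz:
  assumes g: "square_integrable M g" and lip: "L-lipschitz_on UNIV H"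
  shows "square_integrable M (\<lambda>w. H (g w))"
proof (rule square_integrable_bound)
  show "integrable M (\<lambda>w. 2 * (norm (H 0))\<^sup>2 + 2 * (L\<^sup>2 * (norm (g w))\<^sup>2))"
    using g by (simp add: square_integrable_def)
  have "H \<in> borel_measurable borel"
    using lip by (intro borel_measurable_continuous_onI) (rule lipschitz_on_continuous_on)
  then show "(\<lambda>w. H (g w)) \<in> borel_measurable M"
    using g by (auto simp: square_integrable_def)
  fix w
  have "norm (H (g w) - H 0) \<le> L * norm (g w)"
    using lipschitz_onD[OF lip, of "g w" 0] by (simp add: dist_norm)
  then have "(norm (H (g w) - H 0))\<^sup>2 \<le> L\<^sup>2 * (norm (g w))\<^sup>2"
    using power_mono[of "norm (H (g w) - H 0)" "L * norm (g w)" 2] by (simp add: power_mult_distrib)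
  then show "(norm (H (g w)))\<^sup>2 \<le> 2 * (norm (H 0))\<^sup>2 + 2 * (L\<^sup>2 * (norm (g w))\<^sup>2)"
    using norm_add_sq[of "H 0" "H (g w) - H 0"] by simp
qed

lemma square_integrable_inner:
  "square_integrable M g \<Longrightarrow> square_integrable M h \<Longrightarrow> integrable M (\<lambda>w. g w \<bullet> h w)"
  unfolding square_integrable_def by (intro integrable_inner_of_square_integrable) auto

lemma square_integrableD: "square_integrable M g \<Longrightarrow> integrable M (\<lambda>w. (norm (g w))\<^sup>2)"
  by (simp add: square_integrable_def)

lemma (in prob_space) square_integrable_avg_on:
  assumes "\<And>i. i \<in> S \<Longrightarrow> square_integrable M (g i)"
  shows "square_integrable M (\<lambda>w. avg_on S (\<lambda>i. g i w))"
  unfolding avg_on_def by (intro square_integrable_scaleR square_integrable_sum assms)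

section \<open>Decentralized stochastic gradient descent\<close>

text \<open>Agents \<open>R\<close> follow stochastic gradients \<open>G i\<close> of their objectives \<open>f i\<close> and mix the results with
  \<open>A\<close>. The contraction assumption bounds the squared spectral norm of \<open>A\<close> minus the averaging matrix
  by \<open>q\<close>. Self-centered clipping reduces to this process if its contraction constant is zero.\<close>

locale decentralized_sgd = prob_space M
  for M :: "'w measure" +
  fixes R :: "'v::finite set" and A :: "'v \<Rightarrow> 'v \<Rightarrow> real" and q :: real
    and D :: "'v \<Rightarrow> 's measure" and f :: "'v \<Rightarrow> 'a::euclidean_space \<Rightarrow> real"
    and df :: "'v \<Rightarrow> 'a \<Rightarrow> 'a" and G :: "'v \<Rightarrow> 'a \<Rightarrow> 's \<Rightarrow> 'a"
    and L sig zeta :: real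
    and xi :: "'v \<Rightarrow> nat \<Rightarrow> 'w \<Rightarrow> 's" and alpha :: "nat \<Rightarrow> real" and x0 :: "'v \<Rightarrow> 'a"
  assumes R_nonempty: "R \<noteq> {}"
    and row_sum: "i \<in> R \<Longrightarrow> (\<Sum>j\<in>R. A i j) = 1"
    and col_sum: "j \<in> R \<Longrightarrow> (\<Sum>i\<in>R. A i j) = 1"
    and q: "0 \<le> q" "q < 1"
    and contraction: "(\<Sum>i\<in>R. (norm (\<Sum>j\<in>R. (A i j - 1 / real (card R)) *\<^sub>R v j))\<^sup>2)
        \<le> q * (\<Sum>i\<in>R. (norm (v i :: 'a))\<^sup>2)"
    and gradient: "i \<in> R \<Longrightarrow> GDERIV (f i) y :> df i y"
    and lipschitz: "i \<in> R \<Longrightarrow> L-lipschitz_on UNIV (df i)"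
    and heterogeneity: "i \<in> R \<Longrightarrow> (norm (df i y - avg_on R (\<lambda>j. df j y)))\<^sup>2 \<le> zeta\<^sup>2"
    and G_measurable: "i \<in> R \<Longrightarrow> (\<lambda>p. G i (fst p) (snd p)) \<in> borel_measurable (borel \<Otimes>\<^sub>M D i)"
    and D_prob: "i \<in> R \<Longrightarrow> prob_space (D i)"
    and G_integrable: "i \<in> R \<Longrightarrow> integrable (D i) (G i y)"
    and G_unbiased: "i \<in> R \<Longrightarrow> (\<integral>s. G i y s \<partial>D i) = df i y"
    and G_variance: "i \<in> R \<Longrightarrow> integrable (D i) (\<lambda>s. (norm (G i y s - df i y))\<^sup>2)"
      "i \<in> R \<Longrightarrow> (\<integral>s. (norm (G i y s - df i y))\<^sup>2 \<partial>D i) \<le> sig\<^sup>2"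
    and sample_law: "i \<in> R \<Longrightarrow> distr M (D i) (xi i k) = D i"
    and sample_indep: "indep_vars (\<lambda>(i, k). D i) (\<lambda>(i, k). xi i k) (R \<times> UNIV)"
begin

text \<open>The iteration as a function of the table \<open>p\<close> of all samples, so that induction can show
  that the state at time \<open>k\<close> depends only on the samples drawn before \<open>k\<close>.\<close>

primrec state :: "('v \<times> nat \<Rightarrow> 's) \<Rightarrow> nat \<Rightarrow> 'a^'v" where
  "state p 0 = (\<chi> i. x0 i)"
| "state p (Suc k) = (\<chi> i. \<Sum>j\<in>R. A i j *\<^sub>R
     (state p k $ j - alpha k *\<^sub>R G j (state p k $ j) (p (j, k))))"

definition X :: "nat \<Rightarrow> 'w \<Rightarrow> 'a^'v" where
  "X k w = state (\<lambda>(i, l). xi i l w) k"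

definition xbar :: "nat \<Rightarrow> 'w \<Rightarrow> 'a" where
  "xbar k w = avg_on R (\<lambda>i. X k w $ i)"

definition noise :: "'v \<Rightarrow> nat \<Rightarrow> 'w \<Rightarrow> 'a" where
  "noise i k w = G i (X k w $ i) (xi i k w) - df i (X k w $ i)"

definition disagreement :: "nat \<Rightarrow> 'w \<Rightarrow> real" where
  "disagreement k w = (\<Sum>i\<in>R. (norm (X k w $ i - xbar k w))\<^sup>2)"

definition fbar :: "'a \<Rightarrow> real" where
  "fbar y = avg_on R (\<lambda>i. f i y)"

definition dfbar :: "'a \<Rightarrow> 'a" where
  "dfbar y = avg_on R (\<lambda>i. df i y)"

lemma card_R_pos: "real (card R) > 0"
  using R_nonempty by (simp add: card_gt_0_iff)

lemma L_nonneg: "0 \<le> L"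
  using R_nonempty lipschitz by (meson all_not_in_conv lipschitz_on_nonneg)

lemma X_Suc:
  "X (Suc k) w $ i = (\<Sum>j\<in>R. A i j *\<^sub>R (X k w $ j - alpha k *\<^sub>R G j (X k w $ j) (xi j k w)))"
  by (simp add: X_def)

lemma fbar_gradient: "GDERIV fbar y :> dfbar y"
proof -
  have "((\<lambda>y. (1 / real (card R)) *\<^sub>R (\<Sum>i\<in>R. f i y)) has_derivative
      (\<lambda>h. (1 / real (card R)) *\<^sub>R (\<Sum>i\<in>R. h \<bullet> df i y))) (at y)"
    using gradient unfolding gderiv_def
    by (intro has_derivative_scaleR_right has_derivative_sum) auto
  then show ?thesis
    unfolding gderiv_def fbar_def dfbar_def avg_on_def
    by (simp add: inner_sum_right inner_scaleR_right)
qed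

lemma dfbar_lipschitz: "L-lipschitz_on UNIV dfbar"
proof (rule lipschitz_onI)
  fix x y
  have "norm (dfbar x - dfbar y) = norm (\<Sum>i\<in>R. df i x - df i y) / real (card R)"
    by (simp add: dfbar_def avg_on_def sum_subtractf scaleR_diff_right[symmetric])
  also have "\<dots> \<le> (\<Sum>i\<in>R. norm (df i x - df i y)) / real (card R)"
    by (intro divide_right_mono norm_sum) auto
  also have "\<dots> \<le> (\<Sum>i\<in>R. L * norm (x - y)) / real (card R)"
    using lipschitz_onD[OF lipschitz, of _ x y]
    by (intro divide_right_mono sum_mono) (auto simp: dist_norm)
  also have "\<dots> = L * norm (x - y)" using R_nonempty by simp
  finally show "dist (dfbar x) (dfbar y) \<le> L * dist x y" by (simp add: dist_norm)
qed (rule L_nonneg)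

lemma state_restrict: "k \<le> K \<Longrightarrow> state (restrict p (R \<times> {..<K})) k = state p k"
  by (induction k) (auto intro!: sum.cong simp: vec_eq_iff)

text \<open>The state at time \<open>k\<close> is a measurable function of any block of samples that contains all times
  before \<open>k\<close>; the longer blocks \<open>K\<close> are what the induction on \<open>k\<close> needs.\<close>

lemma state_measurable:
  "k \<le> K \<Longrightarrow> (\<lambda>p. state p k) \<in> borel_measurable (\<Pi>\<^sub>M jl\<in>R \<times> {..<K}. case jl of (j, l) \<Rightarrow> D j)"
proof (induction k)
  case 0
  then show ?case by simp
next
  case (Suc k)
  let ?N = "\<Pi>\<^sub>M jl\<in>R \<times> {..<K}. case jl of (j, l) \<Rightarrow> D j"
  have IH: "(\<lambda>p. state p k) \<in> borel_measurable ?N" using Suc by simp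
  then have nth: "(\<lambda>p. state p k $ j) \<in> borel_measurable ?N" for j by simp
  have "(\<lambda>p. G j (state p k $ j) (p (j, k))) \<in> borel_measurable ?N" if "j \<in> R" for j
  proof -
    have "(\<lambda>p. p (j, k)) \<in> measurable ?N (case (j, k) of (j, l) \<Rightarrow> D j)"
      by (rule measurable_component_singleton) (use that Suc in auto)
    then have "(\<lambda>p. (state p k $ j, p (j, k))) \<in> measurable ?N (borel \<Otimes>\<^sub>M D j)"
      using nth[of j] by simp
    from measurable_compose[OF this G_measurable[OF that]] show ?thesis by simp
  qed
  then show ?case
    using nth by (auto intro!: borel_measurable_vec_lambda borel_measurable_sum
        borel_measurable_scaleR borel_measurable_diff)
qed

lemma xi_measurable: "i \<in> R \<Longrightarrow> random_variable (D i) (xi i k)"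
  using sample_indep by (auto simp: indep_vars_def)

lemma X_measurable: "random_variable borel (X k)"
proof -
  have "(\<lambda>w. \<lambda>jl\<in>R \<times> {..<k}. case jl of (j, l) \<Rightarrow> xi j l w)
      \<in> measurable M (\<Pi>\<^sub>M jl\<in>R \<times> {..<k}. case jl of (j, l) \<Rightarrow> D j)"
    by (rule measurable_restrict) (use xi_measurable in auto)
  from measurable_compose[OF this state_measurable[OF order_refl]]
  show ?thesis by (simp add: state_restrict[OF order_refl, of "\<lambda>(i, l). xi i l _"] X_def[abs_def])
qed

text \<open>The samples drawn before time \<open>k\<close> and the sample of agent \<open>i\<close> at time \<open>k\<close> belong to disjoint blocks of
  the independent family.\<close>

lemma X_independent_of_sample:
  assumes "i \<in> R"
  shows "distr M (borel \<Otimes>\<^sub>M D i) (\<lambda>w. (X k w, xi i k w)) = distr M borel (X k) \<Otimes>\<^sub>M D i"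
proof -
  let ?S = "\<lambda>w jl. case jl of (j, l) \<Rightarrow> xi j l w"
  have indep: "indep_var (\<Pi>\<^sub>M jl\<in>R \<times> {..<k}. case jl of (j, l) \<Rightarrow> D j) (\<lambda>w. restrict (?S w) (R \<times> {..<k}))
      (\<Pi>\<^sub>M jl\<in>{(i, k)}. case jl of (j, l) \<Rightarrow> D j) (\<lambda>w. restrict (?S w) {(i, k)})"
    using indep_var_restrict[OF sample_indep, of "R \<times> {..<k}" "{(i, k)}"] assms
    by (auto simp: case_prod_beta')
  have "(\<lambda>p. p (i, k)) \<in> measurable (\<Pi>\<^sub>M jl\<in>{(i, k)}. case jl of (j, l) \<Rightarrow> D j) (case (i, k) of (j, l) \<Rightarrow> D j)"
    by (rule measurable_component_singleton) simp
  then have "(\<lambda>p. p (i, k)) \<in> measurable (\<Pi>\<^sub>M jl\<in>{(i, k)}. case jl of (j, l) \<Rightarrow> D j) (D i)" by simp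
  from joint_law_of_independent_functions[OF indep state_measurable[OF order_refl] this]
  show ?thesis using sample_law[OF assms]
    by (simp add: state_restrict[OF order_refl] X_def[abs_def])
qed

text \<open>The gradient noise is centred and has bounded variance given the past, because the state is
  independent of the current sample.\<close>

lemma
  fixes u :: "'a^'v \<Rightarrow> 'a"
  assumes i: "i \<in> R"
  shows noise_square_integrable: "square_integrable M (noise i k)"
    and noise_variance: "(\<integral>w. (norm (noise i k w))\<^sup>2 \<partial>M) \<le> sig\<^sup>2"
    and noise_orthogonal: "u \<in> borel_measurable borel \<Longrightarrow> square_integrable M (\<lambda>w. u (X k w))
      \<Longrightarrow> (\<integral>w. u (X k w) \<bullet> noise i k w \<partial>M) = 0"
proof -
  \<comment> \<open>the noise as a function of past state and fresh sample\<close>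
  define K where "K = (\<lambda>p. G i (fst p $ i) (snd p) - df i (fst p $ i))"
  have df_meas: "df i \<in> borel_measurable borel"
    using lipschitz[OF i] by (intro borel_measurable_continuous_onI) (rule lipschitz_on_continuous_on)
  have "(\<lambda>p. (fst p $ i, snd p)) \<in> measurable ((borel :: ('a^'v) measure) \<Otimes>\<^sub>M D i) (borel \<Otimes>\<^sub>M D i)"
    by measurable
  from measurable_compose[OF this G_measurable[OF i]] df_meas
  have K: "K \<in> borel_measurable (borel \<Otimes>\<^sub>M D i)"
    unfolding K_def by simp
  interpret Di: prob_space "D i" by (rule D_prob[OF i])
  have noise_eq: "noise i k w = K (X k w, xi i k w)" for w
    by (simp add: noise_def K_def)
  have centred: "integrable (D i) (\<lambda>s. K (y, s))" "(\<integral>s. K (y, s) \<partial>D i) = 0" for y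
    using G_integrable[OF i] G_unbiased[OF i] by (simp_all add: K_def Di.prob_space)
  have var: "integrable (D i) (\<lambda>s. (norm (K (y, s)))\<^sup>2)" "(\<integral>s. (norm (K (y, s)))\<^sup>2 \<partial>D i) \<le> sig\<^sup>2" for y
    using G_variance[OF i] by (simp_all add: K_def)
  note facts = independent_centred_noise[OF X_measurable xi_measurable[OF i] sample_law[OF i]
      X_independent_of_sample[OF i] K centred var]
  have noise_meas: "noise i k \<in> borel_measurable M"
    unfolding noise_eq[abs_def]
    by (rule measurable_compose[OF _ K]) (use X_measurable xi_measurable[OF i] in measurable)
  show "square_integrable M (noise i k)"
    using facts(1)[of "\<lambda>_. 0"] noise_meas by (simp add: square_integrable_def noise_eq)
  show "(\<integral>w. (norm (noise i k w))\<^sup>2 \<partial>M) \<le> sig\<^sup>2"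
    using facts(2)[of "\<lambda>_. 0"] by (simp add: noise_eq)
  assume "u \<in> borel_measurable borel" "square_integrable M (\<lambda>w. u (X k w))"
  then show "(\<integral>w. u (X k w) \<bullet> noise i k w \<partial>M) = 0"
    using facts(4)[of u] by (simp add: square_integrable_def noise_eq)
qed

text \<open>The variance bound is relative to the true gradient, which grows at most linearly; hence second
  moments stay finite from one step to the next.\<close>

lemma X_square_integrable: "square_integrable M (\<lambda>w. X k w $ i)"
proof (induction k arbitrary: i)
  case 0
  then show ?case by (simp add: X_def square_integrable_const)
next
  case (Suc k)
  have "square_integrable M (\<lambda>w. G j (X k w $ j) (xi j k w))" if "j \<in> R" for j
    using square_integrable_add[OF noise_square_integrable[OF that, of k]
        square_integrable_lipschitz[OF Suc[of j] lipschitz[OF that]]]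
    by (simp add: noise_def)
  then show ?case
    unfolding X_Suc
    by (intro square_integrable_sum square_integrable_scaleR square_integrable_diff Suc)
qed

lemma xbar_square_integrable: "square_integrable M (xbar k)"
  unfolding xbar_def[abs_def] by (intro square_integrable_avg_on X_square_integrable)

lemma disagreement_integrable: "integrable M (disagreement k)"
  unfolding disagreement_def[abs_def]
  by (intro Bochner_Integration.integrable_sum square_integrableD square_integrable_diff
      X_square_integrable xbar_square_integrable)

section \<open>Consensus\<close>

text \<open>Unit column sums: mixing preserves the average.\<close>

lemma avg_mix: "avg_on R (\<lambda>i. \<Sum>j\<in>R. A i j *\<^sub>R v j) = avg_on R (v :: 'v \<Rightarrow> 'a)"
proof -
  have "(\<Sum>i\<in>R. \<Sum>j\<in>R. A i j *\<^sub>R v j) = (\<Sum>j\<in>R. (\<Sum>i\<in>R. A i j) *\<^sub>R v j)"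
    unfolding scaleR_sum_left by (rule sum.swap)
  then show ?thesis by (simp add: avg_on_def col_sum)
qed

text \<open>By the unit row sums, \<open>A\<close> minus the averaging matrix annihilates constant vectors, so the
  contraction can be applied to the deviations from the average.\<close>

lemma mixing_contracts:
  fixes v :: "'v \<Rightarrow> 'a"
  shows "(\<Sum>i\<in>R. (norm ((\<Sum>j\<in>R. A i j *\<^sub>R v j) - avg_on R v))\<^sup>2)
      \<le> q * (\<Sum>i\<in>R. (norm (v i - avg_on R v))\<^sup>2)"
proof -
  let ?m = "avg_on R v"
  have zero: "(\<Sum>j\<in>R. v j - ?m) = 0"
    using R_nonempty by (simp add: sum_subtractf avg_on_def sum_constant_scaleR)
  have "(\<Sum>j\<in>R. (A i j - 1 / real (card R)) *\<^sub>R (v j - ?m)) = (\<Sum>j\<in>R. A i j *\<^sub>R v j) - ?m"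
    if "i \<in> R" for i
  proof -
    have "(\<Sum>j\<in>R. (A i j - 1 / real (card R)) *\<^sub>R (v j - ?m))
        = (\<Sum>j\<in>R. A i j *\<^sub>R v j) - (\<Sum>j\<in>R. A i j) *\<^sub>R ?m - (1 / real (card R)) *\<^sub>R (\<Sum>j\<in>R. v j - ?m)"
      unfolding scaleR_sum_left scaleR_sum_right
      by (simp add: sum_subtractf[symmetric] algebra_simps)
    then show ?thesis using zero row_sum[OF that] by simp
  qed
  then show ?thesis
    using contraction[of "\<lambda>j. v j - ?m"] by simp
qed

lemma xbar_Suc:
  "xbar (Suc k) w = xbar k w - alpha k *\<^sub>R
     (avg_on R (\<lambda>i. df i (X k w $ i)) + avg_on R (\<lambda>i. noise i k w))"
proof -
  have "xbar (Suc k) w = avg_on R (\<lambda>j. X k w $ j - alpha k *\<^sub>R G j (X k w $ j) (xi j k w))"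
    unfolding xbar_def X_Suc by (rule avg_mix)
  then show ?thesis
    by (simp add: xbar_def avg_on_def noise_def sum_subtractf scaleR_sum_right[symmetric] algebra_simps)
qed

text \<open>The mixing step contracts the deviations by \<open>q\<close>. The gradient step perturbs them by
  \<open>alpha k\<close> times the deviations of the stochastic gradients, which are bounded via the global
  gradient at the average: the distance to it splits into sampling noise, the Lipschitz
  error of evaluating at the local iterate, and heterogeneity.\<close>

lemma disagreement_step:
  assumes "c > 0"
  shows "disagreement (Suc k) w \<le> q * ((1 + c) * disagreement k w + (1 + 1 / c) * (alpha k)\<^sup>2 *
      (3 * ((\<Sum>i\<in>R. (norm (noise i k w))\<^sup>2) + L\<^sup>2 * disagreement k w + real (card R) * zeta\<^sup>2)))"
proof -
  define g where "g i = G i (X k w $ i) (xi i k w)" for i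
  define v where "v i = X k w $ i - alpha k *\<^sub>R g i" for i
  have avg_v: "avg_on R v = xbar k w - alpha k *\<^sub>R avg_on R g"
    by (simp add: v_def avg_on_def xbar_def sum_subtractf scaleR_sum_right[symmetric] algebra_simps)
  have "(\<Sum>i\<in>R. (norm (g i - avg_on R g))\<^sup>2) \<le> (\<Sum>i\<in>R. (norm (g i - dfbar (xbar k w)))\<^sup>2)"
    using R_nonempty by (intro sum_sq_dev_avg_le) auto
  also have "\<dots> \<le> (\<Sum>i\<in>R. 3 * ((norm (noise i k w))\<^sup>2
      + L\<^sup>2 * (norm (X k w $ i - xbar k w))\<^sup>2 + zeta\<^sup>2))"
  proof (rule sum_mono)
    fix i assume i: "i \<in> R"
    have "norm (df i (X k w $ i) - df i (xbar k w)) \<le> L * norm (X k w $ i - xbar k w)"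
      using lipschitz_onD[OF lipschitz[OF i], of "X k w $ i" "xbar k w"] by (simp add: dist_norm)
    then have lip: "(norm (df i (X k w $ i) - df i (xbar k w)))\<^sup>2 \<le> L\<^sup>2 * (norm (X k w $ i - xbar k w))\<^sup>2"
      using power_mono[of _ _ 2] by (fastforce simp: power_mult_distrib)
    have "g i - dfbar (xbar k w) = noise i k w + (df i (X k w $ i) - df i (xbar k w))
        + (df i (xbar k w) - dfbar (xbar k w))"
      by (simp add: g_def noise_def)
    then have "(norm (g i - dfbar (xbar k w)))\<^sup>2 \<le> 3 * ((norm (noise i k w))\<^sup>2
        + (norm (df i (X k w $ i) - df i (xbar k w)))\<^sup>2 + (norm (df i (xbar k w) - dfbar (xbar k w)))\<^sup>2)"
      by (metis norm_add3_sq)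
    also have "\<dots> \<le> 3 * ((norm (noise i k w))\<^sup>2
        + L\<^sup>2 * (norm (X k w $ i - xbar k w))\<^sup>2 + zeta\<^sup>2)"
      using lip heterogeneity[OF i, of "xbar k w"]
      by (intro mult_left_mono add_mono) (auto simp: dfbar_def)
    finally show "(norm (g i - dfbar (xbar k w)))\<^sup>2 \<le> 3 * ((norm (noise i k w))\<^sup>2
        + L\<^sup>2 * (norm (X k w $ i - xbar k w))\<^sup>2 + zeta\<^sup>2)" .
  qed
  also have "\<dots> = 3 * ((\<Sum>i\<in>R. (norm (noise i k w))\<^sup>2) + L\<^sup>2 * disagreement k w + real (card R) * zeta\<^sup>2)"
    by (simp add: disagreement_def sum.distrib sum_distrib_left[symmetric])
  finally have grads: "(\<Sum>i\<in>R. (norm (g i - avg_on R g))\<^sup>2) \<le> 3 * ((\<Sum>i\<in>R. (norm (noise i k w))\<^sup>2)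
      + L\<^sup>2 * disagreement k w + real (card R) * zeta\<^sup>2)" .
  have "disagreement (Suc k) w \<le> q * (\<Sum>i\<in>R. (norm (v i - avg_on R v))\<^sup>2)"
  proof -
    have X': "X (Suc k) w $ i = (\<Sum>j\<in>R. A i j *\<^sub>R v j)" for i
      by (simp add: X_Suc v_def g_def)
    have "xbar (Suc k) w = avg_on R v"
      unfolding xbar_def X' by (rule avg_mix)
    then show ?thesis unfolding disagreement_def X' using mixing_contracts[of v] by simp
  qed
  also have "\<dots> \<le> q * (\<Sum>i\<in>R. (1 + c) * (norm (X k w $ i - xbar k w))\<^sup>2
      + (1 + 1 / c) * ((alpha k)\<^sup>2 * (norm (g i - avg_on R g))\<^sup>2))"
  proof (intro mult_left_mono sum_mono q)
    fix i
    have "v i - avg_on R v = (X k w $ i - xbar k w) - alpha k *\<^sub>R (g i - avg_on R g)"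
      by (simp add: v_def avg_v algebra_simps)
    then show "(norm (v i - avg_on R v))\<^sup>2 \<le> (1 + c) * (norm (X k w $ i - xbar k w))\<^sup>2
      + (1 + 1 / c) * ((alpha k)\<^sup>2 * (norm (g i - avg_on R g))\<^sup>2)"
      using norm_diff_sq_weighted[OF assms, of "X k w $ i - xbar k w" "alpha k *\<^sub>R (g i - avg_on R g)"]
      by (simp add: power_mult_distrib)
  qed
  also have "\<dots> = q * ((1 + c) * disagreement k w
      + (1 + 1 / c) * (alpha k)\<^sup>2 * (\<Sum>i\<in>R. (norm (g i - avg_on R g))\<^sup>2))"
    by (simp add: disagreement_def sum.distrib sum_distrib_left[symmetric] mult.assoc)
  also have "\<dots> \<le> q * ((1 + c) * disagreement k w + (1 + 1 / c) * (alpha k)\<^sup>2 *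
      (3 * ((\<Sum>i\<in>R. (norm (noise i k w))\<^sup>2) + L\<^sup>2 * disagreement k w + real (card R) * zeta\<^sup>2)))"
    using grads assms q by (intro mult_left_mono add_left_mono) auto
  finally show ?thesis .
qed

lemma noise_sq_integrable: "i \<in> R \<Longrightarrow> integrable M (\<lambda>w. (norm (noise i k w))\<^sup>2)"
  by (rule square_integrableD[OF noise_square_integrable])

lemma sum_noise_variance: "(\<integral>w. (\<Sum>i\<in>R. (norm (noise i k w))\<^sup>2) \<partial>M) \<le> real (card R) * sig\<^sup>2"
proof -
  have "(\<integral>w. (\<Sum>i\<in>R. (norm (noise i k w))\<^sup>2) \<partial>M) = (\<Sum>i\<in>R. \<integral>w. (norm (noise i k w))\<^sup>2 \<partial>M)"
    by (rule Bochner_Integration.integral_sum) (rule noise_sq_integrable)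
  also have "\<dots> \<le> (\<Sum>i\<in>R. sig\<^sup>2)" by (intro sum_mono noise_variance)
  finally show ?thesis by simp
qed

lemma sum_noise_integrable: "integrable M (\<lambda>w. \<Sum>i\<in>R. (norm (noise i k w))\<^sup>2)"
  by (intro Bochner_Integration.integrable_sum noise_sq_integrable)

lemma expected_disagreement_step:
  assumes "c > 0"
  shows "(\<integral>w. disagreement (Suc k) w \<partial>M) \<le> q * ((1 + c) * (\<integral>w. disagreement k w \<partial>M)
      + (1 + 1 / c) * (alpha k)\<^sup>2 * (3 * (real (card R) * sig\<^sup>2
          + L\<^sup>2 * (\<integral>w. disagreement k w \<partial>M) + real (card R) * zeta\<^sup>2)))"
proof -
  note int [simp] = disagreement_integrable sum_noise_integrable
  have "(\<integral>w. disagreement (Suc k) w \<partial>M) \<le> (\<integral>w. q * ((1 + c) * disagreement k w + (1 + 1 / c) * (alpha k)\<^sup>2 *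
      (3 * ((\<Sum>i\<in>R. (norm (noise i k w))\<^sup>2) + L\<^sup>2 * disagreement k w + real (card R) * zeta\<^sup>2))) \<partial>M)"
    by (intro integral_mono disagreement_step assms) auto
  also have "\<dots> = q * ((1 + c) * (\<integral>w. disagreement k w \<partial>M) + (1 + 1 / c) * (alpha k)\<^sup>2 *
      (3 * ((\<integral>w. (\<Sum>i\<in>R. (norm (noise i k w))\<^sup>2) \<partial>M) + L\<^sup>2 * (\<integral>w. disagreement k w \<partial>M)
        + real (card R) * zeta\<^sup>2)))"
    by (simp add: prob_space del: Bochner_Integration.integral_sum)
  also have "\<dots> \<le> q * ((1 + c) * (\<integral>w. disagreement k w \<partial>M)
      + (1 + 1 / c) * (alpha k)\<^sup>2 * (3 * (real (card R) * sig\<^sup>2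
          + L\<^sup>2 * (\<integral>w. disagreement k w \<partial>M) + real (card R) * zeta\<^sup>2)))"
    using sum_noise_variance q assms by (intro mult_left_mono add_mono) auto
  finally show ?thesis .
qed

text \<open>With \<open>c = (1 - q) / 2\<close> the factor \<open>q * (1 + c)\<close> is at most \<open>1 - (1 - q) / 2\<close>. For large \<open>k\<close>
  the Lipschitz term costs at most half of this gap, and the remaining perturbation is of order
  \<open>(alpha k)\<^sup>2\<close>.\<close>

theorem expected_disagreement_tendsto_zero:
  assumes "alpha \<longlonglongrightarrow> 0"
  shows "(\<lambda>k. \<integral>w. disagreement k w \<partial>M) \<longlonglongrightarrow> 0"
proof -
  define c where "c = (1 - q) / 2"
  define b where "b = (1 - q) / 4"
  have pos: "c > 0" "b > 0" "b \<le> 1" using q by (auto simp: c_def b_def)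
  define C where "C = 3 * q * (1 + 1 / c)"
  define e where "e k = C * (alpha k)\<^sup>2 * (real (card R) * (sig\<^sup>2 + zeta\<^sup>2)) / b" for k
  let ?V = "\<lambda>k. \<integral>w. disagreement k w \<partial>M"
  show ?thesis
  proof (rule perturbed_contraction_tendsto_zero[where b="\<lambda>_. b" and e=e])
    show V_nonneg: "0 \<le> ?V k" for k
      by (intro integral_nonneg_AE) (auto simp: disagreement_def intro!: sum_nonneg)
    have "(\<lambda>k. C * (alpha k)\<^sup>2 * L\<^sup>2) \<longlonglongrightarrow> C * 0\<^sup>2 * L\<^sup>2"
      using assms by (intro tendsto_intros)
    then have "\<forall>\<^sub>F k in sequentially. C * (alpha k)\<^sup>2 * L\<^sup>2 < b"
      using pos by (intro order_tendstoD) auto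
    then show "\<forall>\<^sub>F k in sequentially. ?V (Suc k) \<le> (1 - b) * ?V k + b * e k"
    proof eventually_elim
      case (elim k)
      have "q * (1 + c) \<le> 1 - 2 * b"
        using q mult_right_mono[of q 1 "(1 - q) / 2"] by (simp add: c_def b_def field_simps)
      with elim have "q * (1 + c) + C * (alpha k)\<^sup>2 * L\<^sup>2 \<le> 1 - b" by simp
      then have "(q * (1 + c) + C * (alpha k)\<^sup>2 * L\<^sup>2) * ?V k \<le> (1 - b) * ?V k"
        by (intro mult_right_mono V_nonneg)
      moreover have "?V (Suc k) \<le> (q * (1 + c) + C * (alpha k)\<^sup>2 * L\<^sup>2) * ?V k + b * e k"
      proof (rule order_trans[OF expected_disagreement_step[OF pos(1)]])
        have be: "b * e k = C * (alpha k)\<^sup>2 * (real (card R) * (sig\<^sup>2 + zeta\<^sup>2))"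
          using pos by (simp add: e_def)
        show "q * ((1 + c) * ?V k + (1 + 1 / c) * (alpha k)\<^sup>2 *
            (3 * (real (card R) * sig\<^sup>2 + L\<^sup>2 * ?V k + real (card R) * zeta\<^sup>2)))
          \<le> (q * (1 + c) + C * (alpha k)\<^sup>2 * L\<^sup>2) * ?V k + b * e k"
          unfolding be C_def by (simp only: algebra_simps order_refl)
      qed
      ultimately show ?case by linarith
    qed
    have "filterlim (\<lambda>n. real n * b) at_top sequentially"
      using pos by (intro filterlim_at_top_mult_tendsto_pos[OF tendsto_const] filterlim_real_sequentially)
    then show "filterlim (\<lambda>n. \<Sum>k<n. b) at_top sequentially" by simp
    have "e \<longlonglongrightarrow> C * 0\<^sup>2 * (real (card R) * (sig\<^sup>2 + zeta\<^sup>2)) / b"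
      unfolding e_def[abs_def] using assms pos by (intro tendsto_intros) auto
    then show "e \<longlonglongrightarrow> 0" by simp
  qed (use pos in auto)
qed

section \<open>Descent of the objective\<close>

lemma fbar_descent: "fbar y \<le> fbar x + dfbar x \<bullet> (y - x) + L / 2 * (norm (y - x))\<^sup>2"
  by (rule descent_lemma[OF fbar_gradient dfbar_lipschitz])

text \<open>The descent lemma for the averaged iterate, which moves along the average \<open>h\<close> of the local
  gradients plus averaged noise. The polarization identity turns the inner product of the true
  gradient \<open>g\<close> with \<open>h\<close> into half of both squared norms minus the bias
  \<open>(norm (g - h))\<^sup>2 / 2\<close>. The squared norm of \<open>h\<close> absorbs the quadratic term for small steps, that
  of \<open>g\<close> is bounded below by the Polyak-Lojasiewicz inequality, and the bias is controlled by the
  disagreement of the agents.\<close>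

lemma fbar_step:
  assumes PL: "nu * (fbar (xbar k w) - fstar) \<le> (norm (dfbar (xbar k w)))\<^sup>2 / 2"
    and step: "0 \<le> alpha k" "L * alpha k \<le> 1 / 2"
  shows "fbar (xbar (Suc k) w) - fstar \<le> (1 - alpha k * nu) * (fbar (xbar k w) - fstar)
      + alpha k * L\<^sup>2 / (2 * real (card R)) * disagreement k w
      - alpha k * (dfbar (xbar k w) \<bullet> avg_on R (\<lambda>i. noise i k w))
      + L * (alpha k)\<^sup>2 * ((\<Sum>i\<in>R. (norm (noise i k w))\<^sup>2) / real (card R))"
proof -
  define a where "a = alpha k"
  define g where "g = dfbar (xbar k w)"
  define h where "h = avg_on R (\<lambda>i. df i (X k w $ i))"
  define d where "d = avg_on R (\<lambda>i. noise i k w)"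
  have "(norm (g - h))\<^sup>2 \<le> (\<Sum>i\<in>R. (norm (df i (xbar k w) - df i (X k w $ i)))\<^sup>2) / real (card R)"
  proof -
    have "g - h = avg_on R (\<lambda>i. df i (xbar k w) - df i (X k w $ i))"
      by (simp add: g_def h_def dfbar_def avg_on_def sum_subtractf scaleR_diff_right)
    then show ?thesis using norm_avg_sq_le[of R] R_nonempty by simp
  qed
  also have "\<dots> \<le> (\<Sum>i\<in>R. L\<^sup>2 * (norm (X k w $ i - xbar k w))\<^sup>2) / real (card R)"
  proof (intro divide_right_mono sum_mono)
    fix i assume i: "i \<in> R"
    have "norm (df i (xbar k w) - df i (X k w $ i)) \<le> L * norm (X k w $ i - xbar k w)"
      using lipschitz_onD[OF lipschitz[OF i], of "xbar k w" "X k w $ i"]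
      by (simp add: dist_norm norm_minus_commute)
    from power_mono[OF this, of 2]
    show "(norm (df i (xbar k w) - df i (X k w $ i)))\<^sup>2 \<le> L\<^sup>2 * (norm (X k w $ i - xbar k w))\<^sup>2"
      by (simp add: power_mult_distrib)
  qed simp
  also have "\<dots> = L\<^sup>2 / real (card R) * disagreement k w"
    by (simp add: disagreement_def sum_distrib_left[symmetric])
  finally have bias: "(norm (g - h))\<^sup>2 \<le> L\<^sup>2 / real (card R) * disagreement k w" .
  have "(norm d)\<^sup>2 \<le> (\<Sum>i\<in>R. (norm (noise i k w))\<^sup>2) / real (card R)"
    unfolding d_def using R_nonempty by (intro norm_avg_sq_le) auto
  then have noise_bound: "L * a\<^sup>2 * (norm d)\<^sup>2 \<le> L * a\<^sup>2 * ((\<Sum>i\<in>R. (norm (noise i k w))\<^sup>2) / real (card R))"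
    using L_nonneg by (intro mult_left_mono) auto
  have "fbar (xbar (Suc k) w) \<le> fbar (xbar k w) + g \<bullet> (- (a *\<^sub>R (h + d))) + L / 2 * (norm (- (a *\<^sub>R (h + d))))\<^sup>2"
    using fbar_descent[of "xbar (Suc k) w" "xbar k w"]
    by (simp add: xbar_Suc g_def h_def d_def a_def)
  moreover have "(norm (- (a *\<^sub>R (h + d))))\<^sup>2 = a\<^sup>2 * (norm (h + d))\<^sup>2"
    by (simp only: norm_minus_cancel norm_scaleR power_mult_distrib power2_abs)
  moreover have "g \<bullet> (- (a *\<^sub>R (h + d))) = - a * (g \<bullet> h) - a * (g \<bullet> d)"
    by (simp add: inner_add_right algebra_simps)
  ultimately have descent: "fbar (xbar (Suc k) w) \<le> fbar (xbar k w) - a * (g \<bullet> h) - a * (g \<bullet> d)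
      + L / 2 * a\<^sup>2 * (norm (h + d))\<^sup>2"
    by simp
  have "L / 2 * a\<^sup>2 * (norm (h + d))\<^sup>2 \<le> L / 2 * a\<^sup>2 * (2 * (norm h)\<^sup>2 + 2 * (norm d)\<^sup>2)"
    using L_nonneg by (intro mult_left_mono norm_add_sq) auto
  also have "\<dots> = a * (L * a) * (norm h)\<^sup>2 + L * a\<^sup>2 * (norm d)\<^sup>2"
    by (simp add: power2_eq_square algebra_simps)
  also have "a * (L * a) * (norm h)\<^sup>2 \<le> a * (1 / 2) * (norm h)\<^sup>2"
    using step by (intro mult_left_mono mult_right_mono) (auto simp: a_def)
  finally have quad: "L / 2 * a\<^sup>2 * (norm (h + d))\<^sup>2 \<le> a * (norm h)\<^sup>2 / 2 + L * a\<^sup>2 * (norm d)\<^sup>2"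
    by simp
  have gh: "g \<bullet> h = (norm g)\<^sup>2 / 2 + (norm h)\<^sup>2 / 2 - (norm (g - h))\<^sup>2 / 2"
    by (simp add: power2_norm_eq_inner inner_diff_left inner_diff_right inner_commute field_simps)
  have polar: "a * (g \<bullet> h) = a * ((norm g)\<^sup>2 / 2) + a * (norm h)\<^sup>2 / 2 - a * ((norm (g - h))\<^sup>2 / 2)"
    unfolding gh by (simp add: algebra_simps)
  have "a * (nu * (fbar (xbar k w) - fstar)) \<le> a * ((norm g)\<^sup>2 / 2)"
    using PL step by (intro mult_left_mono) (auto simp: a_def g_def)
  moreover have "a * ((norm (g - h))\<^sup>2 / 2) \<le> a * (L\<^sup>2 / real (card R) * disagreement k w / 2)"
    using bias step by (intro mult_left_mono divide_right_mono) (auto simp: a_def)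
  moreover have "a * (L\<^sup>2 / real (card R) * disagreement k w / 2)
      = a * L\<^sup>2 / (2 * real (card R)) * disagreement k w" by simp
  ultimately have "fbar (xbar (Suc k) w) - fstar \<le> (fbar (xbar k w) - fstar) - a * (nu * (fbar (xbar k w) - fstar))
      + a * L\<^sup>2 / (2 * real (card R)) * disagreement k w - a * (g \<bullet> d)
      + L * a\<^sup>2 * ((\<Sum>i\<in>R. (norm (noise i k w))\<^sup>2) / real (card R))"
    using descent quad polar noise_bound by linarith
  then show ?thesis
    by (simp add: a_def g_def d_def left_diff_distrib mult.assoc)
qed

lemma dfbar_measurable: "dfbar \<in> borel_measurable borel"
  using dfbar_lipschitz by (intro borel_measurable_continuous_onI) (rule lipschitz_on_continuous_on)

lemma dfbar_xbar_square_integrable: "square_integrable M (\<lambda>w. dfbar (xbar k w))"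
  by (rule square_integrable_lipschitz[OF xbar_square_integrable dfbar_lipschitz])

text \<open>The gradient at the average is a function of the past, so each agent's noise is orthogonal to it.\<close>

lemma
  shows gradient_noise_integrable: "integrable M (\<lambda>w. dfbar (xbar k w) \<bullet> avg_on R (\<lambda>i. noise i k w))"
    and gradient_noise_orthogonal: "(\<integral>w. dfbar (xbar k w) \<bullet> avg_on R (\<lambda>i. noise i k w) \<partial>M) = 0"
proof -
  define u :: "'a^'v \<Rightarrow> 'a" where "u y = dfbar (avg_on R (\<lambda>i. y $ i))" for y
  have u: "u \<in> borel_measurable borel"
    unfolding u_def[abs_def] avg_on_def
    by (intro measurable_compose[OF _ dfbar_measurable] borel_measurable_scaleR borel_measurable_sum) auto
  have ux: "u (X k w) = dfbar (xbar k w)" for w by (simp add: u_def xbar_def)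
  have int: "integrable M (\<lambda>w. dfbar (xbar k w) \<bullet> noise i k w)" if "i \<in> R" for i
    by (intro square_integrable_inner dfbar_xbar_square_integrable noise_square_integrable that)
  have orth: "(\<integral>w. dfbar (xbar k w) \<bullet> noise i k w \<partial>M) = 0" if "i \<in> R" for i
    using noise_orthogonal[OF that u, of k] dfbar_xbar_square_integrable[of k] by (simp add: ux)
  have eq: "dfbar (xbar k w) \<bullet> avg_on R (\<lambda>i. noise i k w)
      = 1 / real (card R) * (\<Sum>i\<in>R. dfbar (xbar k w) \<bullet> noise i k w)" for w
    by (simp add: avg_on_def inner_scaleR_right inner_sum_right)
  show "integrable M (\<lambda>w. dfbar (xbar k w) \<bullet> avg_on R (\<lambda>i. noise i k w))"
    unfolding eq by (intro integrable_mult_right Bochner_Integration.integrable_sum int)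
  have "(\<integral>w. (\<Sum>i\<in>R. dfbar (xbar k w) \<bullet> noise i k w) \<partial>M) = 0"
    by (subst Bochner_Integration.integral_sum) (auto simp: int orth)
  then show "(\<integral>w. dfbar (xbar k w) \<bullet> avg_on R (\<lambda>i. noise i k w) \<partial>M) = 0"
    unfolding eq by simp
qed

text \<open>A smooth function grows at most quadratically, and it is bounded below.\<close>

lemma fbar_xbar_integrable:
  assumes lower: "\<And>y. fstar \<le> fbar y"
  shows "integrable M (\<lambda>w. fbar (xbar k w))"
proof (rule Bochner_Integration.integrable_bound)
  let ?h = "\<lambda>w. \<bar>fstar\<bar> + (\<bar>fbar 0\<bar> + \<bar>dfbar 0 \<bullet> xbar k w\<bar> + L / 2 * (norm (xbar k w))\<^sup>2)"
  show "integrable M ?h"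
    using square_integrableD[OF xbar_square_integrable]
      square_integrable_inner[OF square_integrable_const xbar_square_integrable] by simp
  have "continuous_on UNIV fbar"
    using fbar_gradient unfolding gderiv_def
    by (meson continuous_at_imp_continuous_on has_derivative_continuous)
  from borel_measurable_continuous_onI[OF this] xbar_square_integrable[of k]
  show "(\<lambda>w. fbar (xbar k w)) \<in> borel_measurable M"
    unfolding square_integrable_def by (metis measurable_compose)
  show "AE w in M. norm (fbar (xbar k w)) \<le> norm (?h w)"
  proof (intro always_eventually allI)
    fix w
    have "fbar (xbar k w) \<le> fbar 0 + dfbar 0 \<bullet> xbar k w + L / 2 * (norm (xbar k w))\<^sup>2"
      using fbar_descent[of "xbar k w" 0] by simp
    moreover have "0 \<le> L / 2 * (norm (xbar k w))\<^sup>2" using L_nonneg by simp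
    ultimately show "norm (fbar (xbar k w)) \<le> norm (?h w)"
      using lower[of "xbar k w"] by (simp add: abs_if split: if_splits)
  qed
qed

text \<open>In expectation the noise term of the descent inequality vanishes. What remains is a contraction
  with rate \<open>alpha k * nu\<close>, perturbed by \<open>alpha k\<close> times the disagreement and by \<open>(alpha k)\<^sup>2\<close>.
  Relative to the rate both perturbations tend to zero.\<close>

theorem expected_objective_tendsto_inf:
  assumes steps: "\<And>k. 0 \<le> alpha k" "alpha \<longlonglongrightarrow> 0"
      "filterlim (\<lambda>n. \<Sum>k<n. alpha k) at_top sequentially"
    and lower: "\<And>y. fstar \<le> fbar y"
    and nu: "0 < nu" and PL: "\<And>y. nu * (fbar y - fstar) \<le> (norm (dfbar y))\<^sup>2 / 2"
  shows "(\<lambda>k. \<integral>w. fbar (xbar k w) \<partial>M) \<longlonglongrightarrow> fstar"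
proof -
  define V where "V k = (\<integral>w. disagreement k w \<partial>M)" for k
  define a where "a k = (\<integral>w. fbar (xbar k w) - fstar \<partial>M)" for k
  define e where "e k = (L\<^sup>2 / (2 * real (card R)) * V k + L * alpha k * sig\<^sup>2) / nu" for k
  note int [simp] = fbar_xbar_integrable[OF lower] disagreement_integrable sum_noise_integrable
    gradient_noise_integrable
  have "a \<longlonglongrightarrow> 0"
  proof (rule perturbed_contraction_tendsto_zero[where b="\<lambda>k. alpha k * nu" and e=e])
    show "0 \<le> a k" for k
      unfolding a_def by (intro integral_nonneg_AE) (simp add: lower)
    have "(\<lambda>k. L * alpha k) \<longlonglongrightarrow> L * 0" using steps by (intro tendsto_intros)
    then have "\<forall>\<^sub>F k in sequentially. L * alpha k < 1 / 2" by (intro order_tendstoD) auto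
    then show "\<forall>\<^sub>F k in sequentially. a (Suc k) \<le> (1 - alpha k * nu) * a k + alpha k * nu * e k"
    proof eventually_elim
      case (elim k)
      have "a (Suc k) \<le> (\<integral>w. (1 - alpha k * nu) * (fbar (xbar k w) - fstar)
          + alpha k * L\<^sup>2 / (2 * real (card R)) * disagreement k w
          - alpha k * (dfbar (xbar k w) \<bullet> avg_on R (\<lambda>i. noise i k w))
          + L * (alpha k)\<^sup>2 * ((\<Sum>i\<in>R. (norm (noise i k w))\<^sup>2) / real (card R)) \<partial>M)"
        unfolding a_def by (intro integral_mono fbar_step PL) (use steps elim in auto)
      also have "\<dots> = (1 - alpha k * nu) * a k + alpha k * L\<^sup>2 / (2 * real (card R)) * V k
          - alpha k * 0 + L * (alpha k)\<^sup>2 * ((\<integral>w. (\<Sum>i\<in>R. (norm (noise i k w))\<^sup>2) \<partial>M) / real (card R))"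
      proof -
        have linear: "(\<integral>w. p * F w + r * U w - s * N w + t * (Q w / c) \<partial>M)
            = p * (\<integral>w. F w \<partial>M) + r * (\<integral>w. U w \<partial>M) - s * (\<integral>w. N w \<partial>M) + t * ((\<integral>w. Q w \<partial>M) / c)"
          if "integrable M F" "integrable M U" "integrable M N" "integrable M Q"
          for p r s t c and F U N Q :: "'w \<Rightarrow> real"
          using that by simp
        show ?thesis
          unfolding a_def V_def gradient_noise_orthogonal[of k, symmetric] by (rule linear) auto
      qed
      also have "\<dots> \<le> (1 - alpha k * nu) * a k + alpha k * L\<^sup>2 / (2 * real (card R)) * V k
          - alpha k * 0 + L * (alpha k)\<^sup>2 * sig\<^sup>2"
        using sum_noise_variance[of k] L_nonneg card_R_pos
        by (intro add_left_mono mult_left_mono) (auto simp: divide_le_eq mult.commute)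
      also have "\<dots> = (1 - alpha k * nu) * a k + alpha k * nu * e k"
      proof -
        have "nu * e k = L\<^sup>2 / (2 * real (card R)) * V k + L * alpha k * sig\<^sup>2"
          using nu by (simp add: e_def)
        then show ?thesis by (simp only: mult.assoc) (simp add: power2_eq_square algebra_simps)
      qed
      finally show ?case .
    qed
    have "(\<lambda>k. alpha k * nu) \<longlonglongrightarrow> 0 * nu" using steps by (intro tendsto_intros)
    then have "\<forall>\<^sub>F k in sequentially. alpha k * nu < 1" by (intro order_tendstoD) auto
    then show "\<forall>\<^sub>F k in sequentially. 0 \<le> alpha k * nu \<and> alpha k * nu \<le> 1"
      by eventually_elim (use steps nu in auto)
    show "filterlim (\<lambda>n. \<Sum>k<n. alpha k * nu) at_top sequentially"
      unfolding sum_distrib_right[symmetric]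
      using nu steps by (intro filterlim_at_top_mult_tendsto_pos[OF tendsto_const])
    have "e \<longlonglongrightarrow> (L\<^sup>2 / (2 * real (card R)) * 0 + L * 0 * sig\<^sup>2) / nu"
      unfolding e_def[abs_def] V_def
      using expected_disagreement_tendsto_zero[OF steps(2)] steps nu by (intro tendsto_intros) auto
    then show "e \<longlonglongrightarrow> 0" by simp
  qed
  then have "(\<lambda>k. a k + fstar) \<longlonglongrightarrow> 0 + fstar" by (intro tendsto_intros)
  moreover have "a k + fstar = (\<integral>w. fbar (xbar k w) \<partial>M)" for k
    by (simp add: a_def prob_space)
  ultimately show ?thesis by simp
qed

end

section \<open>Self-centered clipping with contraction constant zero\<close>

text \<open>The spectral norm concerns real vectors indexed by the agents. It bounds the action on families
  of Euclidean vectors as well, because the matrix acts on each coordinate separately.\<close>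

lemma spectral_norm_on_sum_bound:
  fixes C :: "'v::finite \<Rightarrow> 'v \<Rightarrow> real" and v :: "'v \<Rightarrow> 'a::euclidean_space"
  shows "(\<Sum>i\<in>R. (norm (\<Sum>j\<in>R. C i j *\<^sub>R v j))\<^sup>2) \<le> (spectral_norm_on R C)\<^sup>2 * (\<Sum>i\<in>R. (norm (v i))\<^sup>2)"
proof -
  define T :: "real^'v \<Rightarrow> real^'v" where
    "T = (*v) (\<chi> i j. if i \<in> R \<and> j \<in> R then C i j else 0)"
  \<comment> \<open>one coordinate: extend the scalars by zero outside of \<open>R\<close>\<close>
  have scalar: "(\<Sum>i\<in>R. (\<Sum>j\<in>R. C i j * c j)\<^sup>2) \<le> (spectral_norm_on R C)\<^sup>2 * (\<Sum>i\<in>R. (c i)\<^sup>2)"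
    for c :: "'v \<Rightarrow> real"
  proof -
    define u :: "real^'v" where "u = (\<chi> j. if j \<in> R then c j else 0)"
    have nth: "T u $ i = (if i \<in> R then \<Sum>j\<in>R. C i j * c j else 0)" for i
      by (auto simp: T_def u_def matrix_vector_mult_def if_distrib sum.If_cases cong: if_cong
          intro!: sum.mono_neutral_cong_right)
    have Tu: "(norm (T u))\<^sup>2 = (\<Sum>i\<in>R. (\<Sum>j\<in>R. C i j * c j)\<^sup>2)"
      unfolding power2_norm_eq_inner inner_vec_def
      by (auto simp: power2_eq_square nth intro!: sum.mono_neutral_cong_right)
    have u: "(norm u)\<^sup>2 = (\<Sum>i\<in>R. (c i)\<^sup>2)"
      unfolding power2_norm_eq_inner inner_vec_def
      by (auto simp: u_def power2_eq_square intro!: sum.mono_neutral_cong_right)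
    have "bounded_linear T" unfolding T_def by (rule matrix_vector_mul_bounded_linear)
    then have "norm (T u) \<le> spectral_norm_on R C * norm u"
      unfolding spectral_norm_on_def T_def by (rule onorm)
    from power_mono[OF this, of 2] show ?thesis by (simp add: power_mult_distrib Tu u)
  qed
  have norm_sq: "(norm y)\<^sup>2 = (\<Sum>b\<in>Basis. (y \<bullet> b)\<^sup>2)" for y :: 'a
    unfolding power2_norm_eq_inner by (subst euclidean_inner) (simp add: power2_eq_square)
  have "(\<Sum>i\<in>R. (norm (\<Sum>j\<in>R. C i j *\<^sub>R v j))\<^sup>2)
      = (\<Sum>b\<in>Basis. \<Sum>i\<in>R. (\<Sum>j\<in>R. C i j * (v j \<bullet> b))\<^sup>2)"
    unfolding norm_sq by (subst sum.swap) (simp add: inner_sum_left)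
  also have "\<dots> \<le> (\<Sum>b\<in>Basis. (spectral_norm_on R C)\<^sup>2 * (\<Sum>i\<in>R. (v i \<bullet> b)\<^sup>2))"
    by (intro sum_mono scalar)
  also have "\<dots> = (spectral_norm_on R C)\<^sup>2 * (\<Sum>i\<in>R. (norm (v i))\<^sup>2)"
    unfolding norm_sq sum_distrib_left by (rule sum.swap)
  finally show ?thesis .
qed

text \<open>A contraction constant of zero forces the clipped aggregate to coincide with the virtual
  weighted mean of the reliable messages, whatever the Byzantine agents send.\<close>

lemma SCC_eq_weighted_sum:
  fixes y :: "'v::finite \<Rightarrow> 'a::real_normed_vector"
  assumes W: "weight_matrix E R W" and i: "i \<in> R"
    and contr: "SCC_contraction E R B W 0 t i y"
  shows "SCC W (nbrs E R i \<union> nbrs E B i) t i y = (\<Sum>j\<in>R. virtual_weight E B W i j *\<^sub>R y j)"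
proof -
  have "(\<Sum>j\<in>nbrs E R i \<union> {i}. virtual_weight E B W i j *\<^sub>R y j) = (\<Sum>j\<in>R. virtual_weight E B W i j *\<^sub>R y j)"
  proof (rule sum.mono_neutral_left)
    show "\<forall>j\<in>R - (nbrs E R i \<union> {i}). virtual_weight E B W i j *\<^sub>R y j = 0"
      using W by (auto simp: nbrs_def weight_matrix_def virtual_weight_def)
  qed (use i in \<open>auto simp: nbrs_def\<close>)
  with contr show ?thesis by (simp add: SCC_contraction_def Let_def)
qed

lemma gaussian_noise_zero_AE:
  fixes noise :: "'v \<Rightarrow> nat \<Rightarrow> 'w \<Rightarrow> real^'n"
  assumes "gaussian_noise M R vp sd noise" and "i \<in> R" and "vp i = 0"
  shows "AE om in M. noise i k om = 0"
proof -
  have meas: "noise i k \<in> borel_measurable M" and law: "distr M borel (noise i k) = return borel 0"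
    using assms by (auto simp: gaussian_noise_def iso_gaussian_def)
  have "AE v in return borel (0 :: real^'n). v = 0" by (subst AE_return) auto
  then have "AE v in distr M borel (noise i k). v = 0" unfolding law .
  then show ?thesis using meas by (subst (asm) AE_distr_iff) auto
qed

lemma expected_best_tendsto_inf:
  assumes lim: "(\<lambda>k. \<integral>om. f (xb k om) \<partial>M) \<longlonglongrightarrow> c"
    and lower: "\<And>k. c \<le> (\<integral>om. f (xb k om) \<partial>M)"
  shows "(\<lambda>K. expected_best M f xb (K + 1)) \<longlonglongrightarrow> c"
proof (rule tendsto_sandwich)
  show "\<forall>\<^sub>F K in sequentially. c \<le> expected_best M f xb (K + 1)"
    unfolding expected_best_def by (intro always_eventually allI Min.boundedI) (auto simp: lower)
  show "\<forall>\<^sub>F K in sequentially. expected_best M f xb (K + 1) \<le> (\<integral>om. f (xb (K + 1) om) \<partial>M)"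
    unfolding expected_best_def by (intro always_eventually allI Min_le) auto
  show "(\<lambda>K. \<integral>om. f (xb (K + 1) om) \<partial>M) \<longlonglongrightarrow> c"
    using LIMSEQ_Suc[OF lim] by simp
qed simp

theorem corollary2:
  fixes M :: "'w measure"
    and E :: "('v::finite \<times> 'v) set" and R B :: "'v set" and W :: "real^'v^'v"
    and D :: "'v \<Rightarrow> 's measure" and F :: "'v \<Rightarrow> real^'n \<Rightarrow> 's \<Rightarrow> real"
    and xi :: "'v \<Rightarrow> nat \<Rightarrow> 'w \<Rightarrow> 's" and noise :: "'v \<Rightarrow> nat \<Rightarrow> 'w \<Rightarrow> real^'n"
    and vp :: "'v \<Rightarrow> real" and sd :: "'v \<Rightarrow> nat \<Rightarrow> real" and Lc :: "'v \<Rightarrow> real"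
    and tau :: "nat \<Rightarrow> 'v \<Rightarrow> 'w \<Rightarrow> real" and z :: "nat \<Rightarrow> 'v \<Rightarrow> 'v \<Rightarrow> 'w \<Rightarrow> real^'n"
    and x0 :: "'v \<Rightarrow> real^'n" and x xt :: "nat \<Rightarrow> 'v \<Rightarrow> 'w \<Rightarrow> real^'n"
    and f :: "real^'n \<Rightarrow> real" and fstar :: real
    and sig zeta nu L varpi rho lam varphi eta phi theta theta_min k0 :: real
    and alpha :: "nat \<Rightarrow> real"
  assumes "prob_space M"
    and "agent_network E R B"
    and "weight_matrix E R W"
    and "doubly_stochastic_on R (virtual_weight E B W)"
    and "stochastic_objectives R D F"
    and "f = global_obj R D F"
    and "bdd_below (range f)"
    and "fstar = (INF y. f y)"
    and "smooth_objectives R D F Lc"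
    and "L = Max (Lc ` R)"
    and "sampling_process M R D xi"
    and "bounded_variance_heterogeneity R D F sig zeta"
    and "PL_condition f nu"
    and "gaussian_noise M R vp sd noise"
    and "varpi = sqrt (MAX i\<in>R. (vp i)\<^sup>2)"
    and "DP_SCC_PL M E R B W tau F xi noise alpha z x0 x xt"
    and "\<forall>i\<in>R. \<forall>k. \<forall>om\<in>space M.
           SCC_contraction E R B W rho (tau k i om) i (received R xt z k i om)"
    and "lam = 1 - (spectral_norm_on R
                      (\<lambda>i j. virtual_weight E B W i j - 1 / real (card R)))\<^sup>2"
    and "varphi = lam - 4 * rho * sqrt (real (card R))"
    and "eta = varphi / 2"
    and "phi = varphi / (4 - varphi)"
    and "theta = phi / (4 * sqrt 3 * L)"
    and "theta_min = min theta (1 / nu)"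
    and "k0 > 2 / phi"
    and "0 \<le> rho" and "rho < lam / (4 * sqrt (real (card R)))"
    and "varphi \<in> {0<..<1}" and "eta \<in> {0<..<1}" and "phi \<in> {0<..<1}"
    and "\<forall>k. alpha k = theta_min / (real k + k0)"
    and "varpi = 0" and "rho = 0"
  shows "(\<forall>k. integrable M (\<lambda>om. f (mean_iterate R x k om))) \<and>
         (\<lambda>K. expected_best M f (mean_iterate R x) (K + 1)) \<longlonglongrightarrow> fstar"
proof -
  note prob = assms(1) and net = assms(2) and W = assms(3) and ds = assms(4) and obj = assms(5)
    and f_eq = assms(6) and bdd = assms(7) and fstar_eq = assms(8) and smooth = assms(9)
    and L_eq = assms(10) and sampling = assms(11) and var = assms(12) and PL = assms(13)
    and noise = assms(14) and alg = assms(16) and contr = assms(17) and lam_eq = assms(18)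
  let ?A = "virtual_weight E B W"
  let ?df = "\<lambda>i. grad (local_obj D F i)"
  have R_ne: "R \<noteq> {}" using net by (simp add: agent_network_def)
  interpret prob_space M by fact
  have lam: "1 - lam = (spectral_norm_on R (\<lambda>i j. ?A i j - 1 / real (card R)))\<^sup>2" "0 < lam"
    using assms by auto
  have grads: "GDERIV (local_obj D F i) y :> ?df i y" if "i \<in> R" for i y
    using obj that by (intro differentiable_imp_GDERIV_grad) (auto simp: stochastic_objectives_def)
  have Lc: "0 < Lc i" "Lc i \<le> L" if "i \<in> R" for i
    using smooth that by (auto simp: smooth_objectives_def L_eq)
  have unbiased: "(\<integral>s. sample_grad F i y s \<partial>D i) = ?df i y" if "i \<in> R" for i y
    using obj that by (auto simp: stochastic_objectives_def)
  have G_meas: "(\<lambda>p. sample_grad F i (fst p) (snd p)) \<in> borel_measurable (borel \<Otimes>\<^sub>M D i)"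
    if "i \<in> R" for i
    using obj that by (intro borel_measurable_sample_grad) (auto simp: stochastic_objectives_def intro: borel_measurable_integrable)
  interpret sgd: decentralized_sgd M R ?A "1 - lam" D "local_obj D F" ?df "sample_grad F" L sig zeta
    xi alpha x0
  proof (intro decentralized_sgd.intro decentralized_sgd_axioms.intro)
    show "prob_space M" by fact
    fix i j :: 'v and y :: "real^'n" and v :: "'v \<Rightarrow> real^'n" and k :: nat
    show "R \<noteq> {}" by fact
    show "0 \<le> 1 - lam" "1 - lam < 1" using lam by auto
    show "(\<Sum>i\<in>R. (norm (\<Sum>j\<in>R. (?A i j - 1 / real (card R)) *\<^sub>R v j))\<^sup>2)
        \<le> (1 - lam) * (\<Sum>i\<in>R. (norm (v i))\<^sup>2)"
      unfolding lam(1) by (rule spectral_norm_on_sum_bound)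
    show "(\<Sum>i\<in>R. ?A i j) = 1" if "j \<in> R" using ds that by (simp add: doubly_stochastic_on_def)
    show "indep_vars (\<lambda>(i, k). D i) (\<lambda>(i, k). xi i k) (R \<times> UNIV)"
      using sampling by (simp add: sampling_process_def)
    assume i: "i \<in> R"
    show "(\<Sum>j\<in>R. ?A i j) = 1" using ds i by (simp add: doubly_stochastic_on_def)
    show "GDERIV (local_obj D F i) y :> ?df i y" by (rule grads[OF i])
    show "L-lipschitz_on UNIV (?df i)"
      using smooth i Lc[OF i] by (auto simp: smooth_objectives_def intro: lipschitz_on_le)
    show "(norm (?df i y - avg_on R (\<lambda>j. ?df j y)))\<^sup>2 \<le> zeta\<^sup>2"
    proof -
      have "(\<Sum>j\<in>R. \<integral>s. sample_grad F j y s \<partial>D j) = (\<Sum>j\<in>R. ?df j y)"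
        by (intro sum.cong refl unbiased)
      then show ?thesis
        using var i unbiased[OF i, of y]
        by (auto simp: bounded_variance_heterogeneity_def avg_on_def dest!: bspec spec[of _ y])
    qed
    show "(\<lambda>p. sample_grad F i (fst p) (snd p)) \<in> borel_measurable (borel \<Otimes>\<^sub>M D i)" by (rule G_meas[OF i])
    show "prob_space (D i)" "integrable (D i) (sample_grad F i y)"
      using obj i by (auto simp: stochastic_objectives_def)
    show "(\<integral>s. sample_grad F i y s \<partial>D i) = ?df i y" by (rule unbiased[OF i])
    show "integrable (D i) (\<lambda>s. (norm (sample_grad F i y s - ?df i y))\<^sup>2)"
      "(\<integral>s. (norm (sample_grad F i y s - ?df i y))\<^sup>2 \<partial>D i) \<le> sig\<^sup>2"
      using var i by (auto simp: bounded_variance_heterogeneity_def)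
    show "distr M (D i) (xi i k) = D i"
      using sampling i by (simp add: sampling_process_def)
  qed

  have f: "f = sgd.fbar"
    by (simp add: fun_eq_iff f_eq global_obj_def sgd.fbar_def avg_on_def)
  have df: "grad f y = sgd.dfbar y" for y
    unfolding f by (rule GDERIV_imp_grad) (rule sgd.fbar_gradient)
  have lower: "fstar \<le> sgd.fbar y" for y
    unfolding fstar_eq f[symmetric] using bdd by (rule cINF_lower) simp
  have nu: "0 < nu" and PL': "nu * (sgd.fbar y - fstar) \<le> (norm (sgd.dfbar y))\<^sup>2 / 2" for y
    using PL by (auto simp: PL_condition_def df fstar_eq f[symmetric])
  have "L > 0" using Lc R_ne by fastforce
  then have theta_min: "theta_min > 0" using assms(22-23,29) nu by auto
  have k0: "k0 > 0" using assms(24,29) by (auto intro: less_trans[rotated])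
  have alpha: "alpha = (\<lambda>k. theta_min / (real k + k0))" using assms(30) by auto
  have alpha_lim: "alpha \<longlonglongrightarrow> 0"
    unfolding alpha add.commute[of _ k0]
    by (intro tendsto_divide_0[OF tendsto_const] filterlim_at_top_imp_at_infinity
        filterlim_tendsto_add_at_top[OF tendsto_const] filterlim_real_sequentially)

  have rec0: "x 0 i om = x0 i" and rec_xt: "xt k i om = x k i om - alpha k *\<^sub>R (sample_grad F i (x k i om) (xi i k om) + noise i k om)"
    and rec_SCC: "x (Suc k) i om = SCC W (nbrs E R i \<union> nbrs E B i) (tau k i om) i (received R xt z k i om)"
    if "i \<in> R" "om \<in> space M" for i om k
    using alg that by (auto simp: DP_SCC_PL_def)
  have rec: "x (Suc k) i om = (\<Sum>j\<in>R. ?A i j *\<^sub>R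
      (x k j om - alpha k *\<^sub>R (sample_grad F j (x k j om) (xi j k om) + noise j k om)))"
    if "i \<in> R" "om \<in> space M" for i om k
  proof -
    have "SCC_contraction E R B W 0 (tau k i om) i (received R xt z k i om)"
      using contr that \<open>rho = 0\<close> by auto
    from SCC_eq_weighted_sum[OF W \<open>i \<in> R\<close> this] rec_SCC[OF that] that(2)
    show ?thesis by (simp add: received_def rec_xt)
  qed
  \<comment> \<open>the recursion makes the iterates measurable although the Byzantine messages need not be\<close>
  have x_meas: "x k i \<in> borel_measurable M" if "i \<in> R" for k i
    using that
  proof (induction k arbitrary: i)
    case 0
    then have "x 0 i \<in> borel_measurable M \<longleftrightarrow> (\<lambda>_. x0 i) \<in> borel_measurable M"
      by (intro measurable_cong) (rule rec0)
    then show ?case by simp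
  next
    case (Suc k)
    have "(\<lambda>om. sample_grad F j (x k j om) (xi j k om)) \<in> borel_measurable M" if j: "j \<in> R" for j
      using measurable_compose[OF measurable_Pair[OF Suc.IH[OF j] sgd.xi_measurable[OF j]] G_meas[OF j]]
      by simp
    moreover have "noise j k \<in> borel_measurable M" if "j \<in> R" for j
      using noise that by (simp add: gaussian_noise_def)
    ultimately have "(\<lambda>om. \<Sum>j\<in>R. ?A i j *\<^sub>R
      (x k j om - alpha k *\<^sub>R (sample_grad F j (x k j om) (xi j k om) + noise j k om))) \<in> borel_measurable M"
      using Suc.IH by (intro borel_measurable_sum borel_measurable_scaleR borel_measurable_diff borel_measurable_add) auto
    then show ?case
      using measurable_cong[of M "x (Suc k) i", OF rec[OF Suc.prems]] by simp
  qed
  have mean_meas: "mean_iterate R x k \<in> borel_measurable M" for k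
    unfolding mean_iterate_def[abs_def] by (intro borel_measurable_scaleR borel_measurable_sum x_meas) auto

  have vp: "vp i = 0" if "i \<in> R" for i
  proof -
    have "(vp i)\<^sup>2 \<le> (MAX i\<in>R. (vp i)\<^sup>2)" using that by (intro Max_ge) auto
    moreover have "(MAX i\<in>R. (vp i)\<^sup>2) = 0" using assms(15,31) by simp
    ultimately show ?thesis by simp
  qed
  \<comment> \<open>only almost surely: on a null set the Gaussian perturbations may differ from zero\<close>
  have noiseless: "AE om in M. \<forall>i\<in>R. \<forall>k. noise i k om = 0"
    using gaussian_noise_zero_AE[OF noise _ vp]
    by (intro AE_ball_countable[THEN iffD2] ballI AE_all_countable[THEN iffD2] allI) (auto intro: countable_finite)
  have AE_eq: "AE om in M. mean_iterate R x k om = sgd.xbar k om" for k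
    using AE_space noiseless
  proof eventually_elim
    case (elim om)
    have "x k i om = sgd.X k om $ i" if "i \<in> R" for i
      using that
    proof (induction k arbitrary: i)
      case 0
      then show ?case using elim by (simp add: rec0 sgd.X_def)
    next
      case (Suc k)
      then show ?case using elim by (simp add: rec sgd.X_Suc)
    qed
    then show ?case by (simp add: mean_iterate_def sgd.xbar_def avg_on_def)
  qed
  have f_meas: "f \<in> borel_measurable borel"
    unfolding f using sgd.fbar_gradient unfolding gderiv_def
    by (intro borel_measurable_continuous_onI)
       (meson continuous_at_imp_continuous_on has_derivative_continuous)
  have meas: "(\<lambda>om. f (mean_iterate R x k om)) \<in> borel_measurable M"
    "(\<lambda>om. f (sgd.xbar k om)) \<in> borel_measurable M" for k
    using measurable_compose[OF mean_meas f_meas] measurable_compose[OF _ f_meas]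
      sgd.xbar_square_integrable[of k] by (auto simp: square_integrable_def)
  have AE_f: "AE om in M. f (mean_iterate R x k om) = f (sgd.xbar k om)" for k
    using AE_eq[of k] by eventually_elim simp
  have int: "integrable M (\<lambda>om. f (mean_iterate R x k om))" for k
    using sgd.fbar_xbar_integrable[OF lower, of k]
    unfolding f[symmetric] integrable_cong_AE[OF meas AE_f] .
  have mean_eq: "(\<integral>om. f (mean_iterate R x k om) \<partial>M) = (\<integral>om. f (sgd.xbar k om) \<partial>M)" for k
    by (rule integral_cong_AE[OF meas AE_f])
  have "(\<lambda>k. \<integral>om. f (mean_iterate R x k om) \<partial>M) \<longlonglongrightarrow> fstar"
    unfolding mean_eq unfolding f
  proof (rule sgd.expected_objective_tendsto_inf[OF _ alpha_lim _ lower nu PL'])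
    show "0 \<le> alpha k" for k using theta_min k0 by (simp add: alpha)
    show "filterlim (\<lambda>n. \<Sum>k<n. alpha k) at_top sequentially"
      unfolding alpha by (rule harmonic_steps_diverge[OF theta_min k0])
  qed
  moreover have "fstar \<le> (\<integral>om. f (mean_iterate R x k om) \<partial>M)" for k
    using integral_mono[OF integrable_const int, of fstar k] lower by (simp add: f prob_space)
  ultimately show ?thesis
    using int expected_best_tendsto_inf[of M f "mean_iterate R x" fstar] by blast
qed

end
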